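(* Consider the non-Gaussian mixed linear model described in the context, with finite fourth moments of the random effects and errors. Let $\psi=(\beta',\theta')'$ and $\mathcal I_1=\operatorname{Var}(\partial l/\partial\psi)=(\mathcal I_{1,jk})_{1\le j,k\le p+s+1}$, evaluated at the true parameters and under the true distribution (so index $j\le p$ corresponds to $\beta_j$ and index $p+k+1$ to $\theta_k$, $0\le k\le s$). Then: (a) $\mathcal I_{1,jk}=X_j'V^{-1}X_k$ for $1\le j,k\le p$ (this is $\mathcal I_{1,2,jk}$, and $\mathcal I_{1,1,jk}=0$). (b) For $1\le j\le p$, $0\le k\le s$, $$\mathcal I_{1,j(p+k+1)}=\sum_{t=0}^s\mathrm E(\alpha_{t1}^3)\sum_{l=1}^{m_t}(X_j'V^{-1}z_{tl})(z_{tl}'C_kz_{tl})=\mathrm E\left\{\sum_{t(i_1,i_2,i_3)\ne0}c_{1,j,k}(i_1,i_2,i_3)u_{i_1}u_{i_2}u_{i_3}\right\}$$ (this is $\mathcal I_{1,1,j(p+k+1)}$, and $\mathcal I_{1,2,j(p+k+1)}=0$). (c) For $0\le j,k\le s$, $$\mathcal I_{1,(p+j+1)(p+k+1)}=2\operatorname{tr}(C_jVC_kV)+\sum_{t=0}^s\kappa_t\sum_{l=1}^{m_t}(z_{tl}'C_jz_{tl})(z_{tl}'C_kz_{tl})$$ $$=\mathrm E\left\{\sum_{f(i_1,\dots,i_4)\ne0}c_{2,j,k}(i_1,\dots,i_4)u_{i_1}\cdots u_{i_4}\right\}+\left\{2\operatorname{tr}(C_jVC_kV)-3\lambda^2\sum_{f(i_1,\dots,i_4)\ne0}c_{2,j,k}(i_1,\dots,i_4)\Gamma(i_1,i_3)\Gamma(i_2,i_4)\right\}$$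 (the two terms being $\mathcal I_{1,1,(p+j+1)(p+k+1)}$ and $\mathcal I_{1,2,(p+j+1)(p+k+1)}$). Here $c_{1,j,k}(i_1,i_2,i_3)=c_{1,j,k,l}$ if $t(i_1,i_2,i_3)=t_l$ ($1\le l\le K$) and $c_{2,j,k}(i_1,\dots,i_4)=c_{2,j,k,l}$ if $f(i_1,\dots,i_4)=f_l$ ($1\le l\le L$), with $$c_{1,j,k,l}=\frac1{|\{t(i_1,i_2,i_3)=t_l\}|}\sum_{t(i_1,i_2,i_3)=t_l}q_{j,i_1}C_{k,i_2,i_3},\qquad c_{2,j,k,l}=\frac1{|\{f(i_1,\dots,i_4)=f_l\}|}\sum_{f(i_1,\dots,i_4)=f_l}C_{j,i_1,i_2}C_{k,i_3,i_4}.$$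
   Context: Model: $y=X\beta+Z_1\alpha_1+\cdots+Z_s\alpha_s+\varepsilon$, where $y$ is an $N\times1$ vector of observations, $X$ ($N\times p$, rank $p$) and $Z_t$ ($N\times m_t$, $1\le t\le s$) are known real matrices, $\beta\in\mathbb R^p$ is unknown, $\alpha_t$ is an $m_t\times1$ vector of random effects, $\varepsilon$ is an $N\times1$ vector of errors. The vectors $\alpha_1,\dots,\alpha_s,\varepsilon$ are independent; the components of $\alpha_t$ are i.i.d. with mean $0$ and variance $\sigma_t^2$, and the components of $\varepsilon$ are i.i.d. with mean $0$ and variance $\sigma_0^2>0$. No normality is assumed. Put $\alpha_0=\varepsilon$, $Z_0=I$ (the $N\times N$ identity), $m_0=N$; $\lambda=\sigma_0^2$, $\gamma_t=\sigma_t^2/\sigma_0^2$, $\gamma_0=1$; $\theta=(\theta_0,\dots,\theta_s)'=(\lambda,\gamma_1,\dots,\gamma_s)'$; $u=y-X\beta$ with components $u_i$. $V=\operatorname{Var}(y)=\lambda(I+\gamma_1Z_1Z_1'+\cdots+\gamma_sZ_sZ_s')$. The Gaussian (quasi-)log-likelihood is $l(\beta,\theta)=c-\frac12\{\log|V|+(y-X\beta)'V^{-1}(y-X\beta)\}$, $c$ constant. Its derivatives are $\partial l/\partial\beta=X'V^{-1}u$ and $\partial l/\partial\theta_j=u'C_ju-\mathrm E(u'C_ju)$, $0\le j\le s$, with $C_0=(2\lambda)^{-1}V^{-1}$, $C_j=(\lambda/2)V^{-1}Z_jZ_j'V^{-1}$ for $1\le j\le s$. $C_{j,i_1,i_2}$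 is the $(i_1,i_2)$ entry of $C_j$; $X_j$ is the $j$th column of $X$; $q_j=V^{-1}X_j=(q_{j,i})_{1\le i\le N}$. $z_{it}'$ denotes the $i$th row of $Z_t$ ($1\le i\le N$) and $z_{tl}$ the $l$th column of $Z_t$ ($1\le l\le m_t$). $a_1\cdot a_2\cdots a_k=\sum_la_{1l}a_{2l}\cdots a_{kl}$. $\kappa_t=\mathrm E(\alpha_{t1}^4)-3\sigma_t^4$; $\Gamma(i_1,i_2)=\sum_{t=0}^s\gamma_t(z_{i_1t}\cdot z_{i_2t})$. $f(i_1,\dots,i_4)=\sum_{t=0}^s\kappa_t\,z_{i_1t}\cdot z_{i_2t}\cdot z_{i_3t}\cdot z_{i_4t}$ is regarded as a linear function of $(\kappa_0,\dots,\kappa_s)$, i.e. identified with its coefficient vector; $f_1,\dots,f_L$ are the distinct nonzero functions so arising for $(i_1,\dots,i_4)\in\{1,\dots,N\}^4$. Likewise $t(i_1,i_2,i_3)=\mathrm E(u_{i_1}u_{i_2}u_{i_3})=\sum_{t=0}^s\mathrm E(\alpha_{t1}^3)\,z_{i_1t}\cdot z_{i_2t}\cdot z_{i_3t}$ is regarded as a linear function of the third moments $(\mathrm E(\alpha_{t1}^3))_{0\le t\le s}$, identified with its coefficient vector; $t_1,\dots,t_K$ are the distinct nonzero functions so arising. Equalities/inequalities for $f$ and $t$ are between functions. $|\{\cdots\}|$ is the cardinality of the set of index tuples. *)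

theory Defs
  imports
    "HOL-Probability.Probability"
    "Jordan_Normal_Form.DL_Rank"
    "Jordan_Normal_Form.Gauss_Jordan_Elimination"
begin

unbundle no vec_syntax
unbundle no inner_syntax

text \<open>
  Indices of vectors and matrices start at 0.  The error vector is treated as the 0-th random
  effect: \<open>Z 0\<close> is the identity matrix of order \<open>N\<close>, and \<open>\<alpha> t l \<omega>\<close> is the \<open>l\<close>-th component of
  the \<open>t\<close>-th random effect.  The number \<open>m t\<close> of random effects is \<open>dim_col (Z t)\<close>.
\<close>

definition mat_inv :: "real mat \<Rightarrow> real mat" where
  "mat_inv A = the (mat_inverse A)"

definition mat_trace :: "real mat \<Rightarrow> real" where
  "mat_trace A = (\<Sum>i<dim_row A. A $$ (i, i))"

text \<open>
  The variance parameters are \<open>\<theta> = (\<lambda>, \<gamma>\<^sub>1, \<dots>, \<gamma>\<^sub>s)\<close>, with the convention \<open>\<gamma>\<^sub>0 = 1\<close>; hence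
  \<open>\<theta> $ 0\<close> is \<open>\<lambda>\<close> and not \<open>\<gamma>\<^sub>0\<close>.
\<close>

definition gam :: "real vec \<Rightarrow> nat \<Rightarrow> real" where
  "gam \<theta> t = (if t = 0 then 1 else \<theta> $ t)"

definition cov_mat :: "nat \<Rightarrow> nat \<Rightarrow> (nat \<Rightarrow> real mat) \<Rightarrow> real vec \<Rightarrow> real mat" where
  "cov_mat N s Z \<theta> = (\<theta> $ 0) \<cdot>\<^sub>m
     (1\<^sub>m N + mat N N (\<lambda>(i, i'). \<Sum>t=1..s. gam \<theta> t * (Z t * transpose_mat (Z t)) $$ (i, i')))"

definition gauss_loglik ::
  "real \<Rightarrow> nat \<Rightarrow> nat \<Rightarrow> real mat \<Rightarrow> (nat \<Rightarrow> real mat) \<Rightarrow> real vec \<Rightarrow> real vec \<Rightarrow> real vec \<Rightarrow> real" where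
  "gauss_loglik c N s X Z y \<beta> \<theta> = c - 1/2 *
     (ln (det (cov_mat N s Z \<theta>)) +
      (y - X *\<^sub>v \<beta>) \<bullet> (mat_inv (cov_mat N s Z \<theta>) *\<^sub>v (y - X *\<^sub>v \<beta>)))"

text \<open>
  The \<open>j\<close>-th partial derivative of the log-likelihood at \<open>\<psi> = (\<beta>, \<theta>)\<close>, for \<open>j < p + s + 1\<close>.
\<close>

definition score ::
  "real \<Rightarrow> nat \<Rightarrow> nat \<Rightarrow> nat \<Rightarrow> real mat \<Rightarrow> (nat \<Rightarrow> real mat) \<Rightarrow> real vec \<Rightarrow> real vec \<Rightarrow> nat \<Rightarrow> real" where
  "score c N p s X Z y \<psi> j =
     deriv (\<lambda>h. let \<psi>' = \<psi> + h \<cdot>\<^sub>v unit_vec (p + s + 1) j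
                in gauss_loglik c N s X Z y (vec_first \<psi>' p) (vec_last \<psi>' (s + 1))) 0"

definition var_mat :: "'w measure \<Rightarrow> nat \<Rightarrow> (nat \<Rightarrow> 'w \<Rightarrow> real) \<Rightarrow> real mat" where
  "var_mat M n S = mat n n (\<lambda>(j, k).
     \<integral>\<omega>. (S j \<omega> - (\<integral>\<omega>'. S j \<omega>' \<partial>M)) * (S k \<omega> - (\<integral>\<omega>'. S k \<omega>' \<partial>M)) \<partial>M)"

text \<open>The matrices of the quadratic forms in the derivatives with respect to \<open>\<theta>\<close>.\<close>

definition Cmat :: "nat \<Rightarrow> nat \<Rightarrow> (nat \<Rightarrow> real mat) \<Rightarrow> real vec \<Rightarrow> nat \<Rightarrow> real mat" where
  "Cmat N s Z \<theta> j =
     (let W = mat_inv (cov_mat N s Z \<theta>)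
      in if j = 0 then (1 / (2 * \<theta> $ 0)) \<cdot>\<^sub>m W
         else (\<theta> $ 0 / 2) \<cdot>\<^sub>m (W * Z j * transpose_mat (Z j) * W))"

definition Gam :: "nat \<Rightarrow> (nat \<Rightarrow> real mat) \<Rightarrow> real vec \<Rightarrow> nat \<Rightarrow> nat \<Rightarrow> real" where
  "Gam s Z \<theta> i1 i2 = (\<Sum>t\<le>s. gam \<theta> t * (row (Z t) i1 \<bullet> row (Z t) i2))"

text \<open>
  Coefficient vectors of \<open>E(u\<^sub>i\<^sub>1 u\<^sub>i\<^sub>2 u\<^sub>i\<^sub>3)\<close> as a linear function of the third moments, and of
  the fourth-order functions \<open>f\<close> as linear functions of the \<open>\<kappa>\<^sub>t\<close>, for \<open>t = 0, \<dots>, s\<close>.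
\<close>

definition tfun :: "nat \<Rightarrow> (nat \<Rightarrow> real mat) \<Rightarrow> nat \<times> nat \<times> nat \<Rightarrow> real vec" where
  "tfun s Z = (\<lambda>(i1, i2, i3). vec (s + 1) (\<lambda>t.
     \<Sum>l<dim_col (Z t). Z t $$ (i1, l) * Z t $$ (i2, l) * Z t $$ (i3, l)))"

definition ffun :: "nat \<Rightarrow> (nat \<Rightarrow> real mat) \<Rightarrow> nat \<times> nat \<times> nat \<times> nat \<Rightarrow> real vec" where
  "ffun s Z = (\<lambda>(i1, i2, i3, i4). vec (s + 1) (\<lambda>t.
     \<Sum>l<dim_col (Z t). Z t $$ (i1, l) * Z t $$ (i2, l) * Z t $$ (i3, l) * Z t $$ (i4, l)))"

definition idx3 :: "nat \<Rightarrow> (nat \<times> nat \<times> nat) set" where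
  "idx3 N = {..<N} \<times> {..<N} \<times> {..<N}"

definition idx4 :: "nat \<Rightarrow> (nat \<times> nat \<times> nat \<times> nat) set" where
  "idx4 N = {..<N} \<times> {..<N} \<times> {..<N} \<times> {..<N}"

text \<open>
  Averages over the level sets of \<open>tfun\<close> and \<open>ffun\<close>; the argument \<open>g\<close> is the value
  (\<open>t\<^sub>l\<close> or \<open>f\<^sub>l\<close>) that determines the level set.
\<close>

definition c1_level ::
  "nat \<Rightarrow> nat \<Rightarrow> (nat \<Rightarrow> real mat) \<Rightarrow> real vec \<Rightarrow> real mat \<Rightarrow> real vec \<Rightarrow> real" where
  "c1_level N s Z q C g =
     1 / real (card {i \<in> idx3 N. tfun s Z i = g}) *
     (\<Sum>(i1, i2, i3) \<in> {i \<in> idx3 N. tfun s Z i = g}. q $ i1 * C $$ (i2, i3))"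

definition c2_level ::
  "nat \<Rightarrow> nat \<Rightarrow> (nat \<Rightarrow> real mat) \<Rightarrow> real mat \<Rightarrow> real mat \<Rightarrow> real vec \<Rightarrow> real" where
  "c2_level N s Z C C' g =
     1 / real (card {i \<in> idx4 N. ffun s Z i = g}) *
     (\<Sum>(i1, i2, i3, i4) \<in> {i \<in> idx4 N. ffun s Z i = g}. C $$ (i1, i2) * C' $$ (i3, i4))"

definition c1 ::
  "nat \<Rightarrow> nat \<Rightarrow> real mat \<Rightarrow> (nat \<Rightarrow> real mat) \<Rightarrow> real vec \<Rightarrow> nat \<Rightarrow> nat \<Rightarrow> nat \<times> nat \<times> nat \<Rightarrow> real" where
  "c1 N s X Z \<theta> j k i =
     c1_level N s Z (mat_inv (cov_mat N s Z \<theta>) *\<^sub>v col X j) (Cmat N s Z \<theta> k) (tfun s Z i)"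

definition c2 ::
  "nat \<Rightarrow> nat \<Rightarrow> (nat \<Rightarrow> real mat) \<Rightarrow> real vec \<Rightarrow> nat \<Rightarrow> nat \<Rightarrow> nat \<times> nat \<times> nat \<times> nat \<Rightarrow> real" where
  "c2 N s Z \<theta> j k i = c2_level N s Z (Cmat N s Z \<theta> j) (Cmat N s Z \<theta> k) (ffun s Z i)"

text \<open>
  The two parts \<open>I\<^sub>1\<^sub>,\<^sub>1\<close> and \<open>I\<^sub>1\<^sub>,\<^sub>2\<close> of the quasi-information matrix, both symmetric.
  Positions \<open>j < p\<close> belong to \<open>\<beta>\<^sub>j\<close>, positions \<open>p + k\<close> with \<open>k \<le> s\<close> to \<open>\<theta>\<^sub>k\<close>.
\<close>

definition info_part1 ::
  "'w measure \<Rightarrow> nat \<Rightarrow> nat \<Rightarrow> nat \<Rightarrow> real mat \<Rightarrow> (nat \<Rightarrow> real mat) \<Rightarrow> real vec \<Rightarrow> ('w \<Rightarrow> real vec) \<Rightarrow> real mat"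
where
  "info_part1 M N p s X Z \<theta> u =
     (let b1 = (\<lambda>j k. \<integral>\<omega>. (\<Sum>(i1, i2, i3) \<in> {i \<in> idx3 N. tfun s Z i \<noteq> 0\<^sub>v (s + 1)}.
                  c1 N s X Z \<theta> j k (i1, i2, i3) * (u \<omega> $ i1 * u \<omega> $ i2 * u \<omega> $ i3)) \<partial>M);
          b2 = (\<lambda>j k. \<integral>\<omega>. (\<Sum>(i1, i2, i3, i4) \<in> {i \<in> idx4 N. ffun s Z i \<noteq> 0\<^sub>v (s + 1)}.
                  c2 N s Z \<theta> j k (i1, i2, i3, i4) *
                  (u \<omega> $ i1 * u \<omega> $ i2 * u \<omega> $ i3 * u \<omega> $ i4)) \<partial>M)
      in mat (p + s + 1) (p + s + 1) (\<lambda>(a, b).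
           if a < p \<and> b < p then 0
           else if a < p then b1 a (b - p)
           else if b < p then b1 b (a - p)
           else b2 (a - p) (b - p)))"

definition info_part2 ::
  "nat \<Rightarrow> nat \<Rightarrow> nat \<Rightarrow> real mat \<Rightarrow> (nat \<Rightarrow> real mat) \<Rightarrow> real vec \<Rightarrow> real mat" where
  "info_part2 N p s X Z \<theta> =
     (let V = cov_mat N s Z \<theta>; C = Cmat N s Z \<theta>
      in mat (p + s + 1) (p + s + 1) (\<lambda>(a, b).
           if a < p \<and> b < p then col X a \<bullet> (mat_inv V *\<^sub>v col X b)
           else if a < p \<or> b < p then 0
           else 2 * mat_trace (C (a - p) * V * C (b - p) * V)
                - 3 * (\<theta> $ 0)\<^sup>2 * (\<Sum>(i1, i2, i3, i4) \<in> {i \<in> idx4 N. ffun s Z i \<noteq> 0\<^sub>v (s + 1)}.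
                    c2 N s Z \<theta> (a - p) (b - p) (i1, i2, i3, i4) *
                    (Gam s Z \<theta> i1 i3 * Gam s Z \<theta> i2 i4))))"

end

theory Submission
  imports Defs
begin

text \<open>
  The covariance matrix is affine in each variance parameter, so Jacobi's formula for the determinant
  and the resolvent identity for the inverse turn the score into linear and quadratic forms in \<open>u\<close>,
  up to constants.  Each \<open>u\<^sub>i\<close> is a linear form in the jointly independent centered variables
  \<open>\<alpha>\<^sub>t\<^sub>l\<close>, whose mixed moments up to order four vanish unless the indices coincide or pair up.
  The triple and quadruple coincidences give \<open>t\<close> and \<open>f\<close>, the pairings give products of entries of
  \<open>V\<close>.  Averaging the coefficients over level sets does not change sums against \<open>t\<close> or \<open>f\<close>.  Since
  \<open>f\<close> is symmetric, the averaged coefficients weigh the three pairings equally, which is where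
  the correction \<open>3 \<lambda>\<^sup>2 \<Gamma> \<Gamma>\<close> comes from.
\<close>

section \<open>Moments of linear forms in independent variables\<close>

text \<open>Pairings play two different roles in part (c). The expectation of four factors
  \<open>u\<close> keeps its Gaussian pairings even for tuples with f = 0, so the restriction to f
  \<noteq> 0 loses some of them; and averaging distorts those that are kept, because products of
  entries of V, unlike f, need not be constant on level sets. Hence the second part carries the
  whole trace in closed form and takes back the pairings produced by the first. Part (b) needs no
  such correction: third moments of centered independent variables have no pairings, so the
  expectation of three factors \<open>u\<close> is t itself. Two obstacles come before this.
  Independence is given in two layers, between the vectors and inside each of them, and has to be
  fused into one family indexed by pairs. And the score is the derivative of the actual
  log-likelihood, where the logarithm needs a positive determinant and \<open>mat_inv\<close> a
  nonzero one. The error component makes V positive definite, and continuity extends invertibility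
  to nearby parameters.\<close>

text \<open>A finite set of pairs splits into fibres over its first coordinates. The events over one
  fibre intersect in the preimage of a single cylinder in the product space of that vector, so
  independence of the vectors separates the fibres, and independence of the components separates the
  events inside each fibre.\<close>

lemma (in prob_space) indep_vars_Sigma:
  fixes X :: "'i \<Rightarrow> 'j \<Rightarrow> 'a \<Rightarrow> 'b"
  assumes vecs: "indep_vars (\<lambda>i. PiM (J i) (M' i)) (\<lambda>i \<omega>. \<lambda>j\<in>J i. X i j \<omega>) I"
    and comps: "\<And>i. i \<in> I \<Longrightarrow> indep_vars (M' i) (X i) (J i)"
  shows "indep_vars (\<lambda>(i, j). M' i j) (\<lambda>(i, j). X i j) (Sigma I J)"
  unfolding indep_vars_def2
proof (intro conjI indep_setsI ballI)
  have rv: "random_variable (M' i j) (X i j)" if "i \<in> I" "j \<in> J i" for i j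
    using comps[OF that(1)] that(2) by (auto simp: indep_vars_def2)
  show rv': "random_variable (case a of (i, j) \<Rightarrow> M' i j) (case a of (i, j) \<Rightarrow> X i j)"
    if "a \<in> Sigma I J" for a
    using that rv by auto
  show "{(case a of (i, j) \<Rightarrow> X i j) -` A \<inter> space M |A. A \<in> sets (case a of (i, j) \<Rightarrow> M' i j)}
      \<subseteq> events" if "a \<in> Sigma I J" for a
    using measurable_sets[OF rv'[OF that]] by auto
next
  fix E :: "'i \<times> 'j \<Rightarrow> 'a set" and K
  assume K: "K \<noteq> {}" "K \<subseteq> Sigma I J" "finite K"
    and E: "\<forall>a\<in>K. E a \<in> {(case a of (i, j) \<Rightarrow> X i j) -` A \<inter> space M |A.
             A \<in> sets (case a of (i, j) \<Rightarrow> M' i j)}"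
  from E have "\<forall>a\<in>K. \<exists>B. B \<in> sets (M' (fst a) (snd a)) \<and>
      E a = X (fst a) (snd a) -` B \<inter> space M"
    by (auto simp: case_prod_beta)
  then obtain B where B: "\<And>i j. (i, j) \<in> K \<Longrightarrow> B (i, j) \<in> sets (M' i j)"
    and EB: "\<And>i j. (i, j) \<in> K \<Longrightarrow> E (i, j) = X i j -` B (i, j) \<inter> space M"
    unfolding bchoice_iff by force
  define L where "L = fst ` K"
  define S where "S i = {j. (i, j) \<in> K}" for i
  have L: "L \<noteq> {}" "finite L" "L \<subseteq> I" using K by (auto simp: L_def)
  have S: "S i \<noteq> {}" "finite (S i)" "S i \<subseteq> J i" if "i \<in> L" for i
  proof -
    show "S i \<noteq> {}" "S i \<subseteq> J i" using that K by (auto simp: L_def S_def)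
    have "S i \<subseteq> snd ` K" by (force simp: S_def)
    then show "finite (S i)" using K finite_subset by blast
  qed
  have KS: "K = Sigma L S" by (force simp: L_def S_def)
  define D where "D i = {x \<in> space (PiM (J i) (M' i)). \<forall>j\<in>S i. x j \<in> B (i, j)}" for i
  have D: "D i \<in> sets (PiM (J i) (M' i))" if "i \<in> L" for i
    unfolding D_def
  proof (rule sets.sets_Collect_finite_All)
    fix j assume j: "j \<in> S i"
    have "(\<lambda>x. x j) -` B (i, j) \<inter> space (PiM (J i) (M' i)) \<in> sets (PiM (J i) (M' i))"
      using j S(3)[OF that] B by (intro measurable_sets[OF measurable_component_singleton])
        (auto simp: S_def)
    also have "(\<lambda>x. x j) -` B (i, j) \<inter> space (PiM (J i) (M' i)) =
        {x \<in> space (PiM (J i) (M' i)). x j \<in> B (i, j)}" by auto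
    finally show "{x \<in> space (PiM (J i) (M' i)). x j \<in> B (i, j)} \<in> sets (PiM (J i) (M' i))" .
  qed (use S[OF that] in auto)
  have DE: "(\<lambda>\<omega>. \<lambda>j\<in>J i. X i j \<omega>) -` D i \<inter> space M = (\<Inter>j\<in>S i. X i j -` B (i, j) \<inter> space M)"
    if "i \<in> L" for i
  proof -
    have "(\<lambda>j\<in>J i. X i j \<omega>) \<in> space (PiM (J i) (M' i))" if \<omega>: "\<omega> \<in> space M" for \<omega>
      using comps[of i] L(3) \<open>i \<in> L\<close> \<omega>
      by (auto simp: space_PiM indep_vars_def2 intro: measurable_space)
    \<comment> \<open>Nonemptiness of \<open>S i\<close> matters: an empty intersection on the right
      would be the whole type and not a subset of \<open>space M\<close>.\<close>
    then show ?thesis using S[OF that] by (auto simp: D_def)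
  qed
  have "(\<Inter>a\<in>K. E a) = (\<Inter>i\<in>L. \<Inter>j\<in>S i. E (i, j))"
    by (auto simp: KS)
  also have "\<dots> = (\<Inter>i\<in>L. (\<lambda>\<omega>. \<lambda>j\<in>J i. X i j \<omega>) -` D i \<inter> space M)"
    using EB by (intro INF_cong refl) (simp add: DE, simp add: S_def)
  finally have "prob (\<Inter>a\<in>K. E a) = prob (\<Inter>i\<in>L. (\<lambda>\<omega>. \<lambda>j\<in>J i. X i j \<omega>) -` D i \<inter> space M)"
    by simp
  also have "\<dots> = (\<Prod>i\<in>L. prob ((\<lambda>\<omega>. \<lambda>j\<in>J i. X i j \<omega>) -` D i \<inter> space M))"
    using D L by (intro indep_varsD[OF vecs]) auto
  also have "\<dots> = (\<Prod>i\<in>L. \<Prod>j\<in>S i. prob (E (i, j)))"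
  proof (rule prod.cong[OF refl])
    fix i assume i: "i \<in> L"
    then have "prob (\<Inter>j\<in>S i. X i j -` B (i, j) \<inter> space M) =
        (\<Prod>j\<in>S i. prob (X i j -` B (i, j) \<inter> space M))"
      using S[OF i] B L by (intro indep_varsD[OF comps]) (auto simp: S_def)
    then show "prob ((\<lambda>\<omega>. \<lambda>j\<in>J i. X i j \<omega>) -` D i \<inter> space M) = (\<Prod>j\<in>S i. prob (E (i, j)))"
      using EB by (simp add: DE[OF i] S_def)
  qed
  also have "\<dots> = (\<Prod>a\<in>K. prob (E a))"
    using L S by (simp add: KS prod.Sigma)
  finally show "prob (\<Inter>a\<in>K. E a) = (\<Prod>a\<in>K. prob (E a))" .
qed

section \<open>Mixed moments of independent centered variables up to order four\<close>

text \<open>Independence speaks about distinct indices, so the repeated factors of a monomial are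
  first gathered into powers.\<close>

lemma prod_list_map_eq_prod_count_list:
  fixes f :: "'i \<Rightarrow> 'b :: comm_monoid_mult"
  assumes "set xs \<subseteq> J" "finite J"
  shows "prod_list (map f xs) = (\<Prod>x\<in>J. f x ^ count_list xs x)"
  using assms
proof (induction xs)
  case (Cons a xs)
  then have "(\<Prod>x\<in>J. f x ^ count_list (a # xs) x) =
      (\<Prod>x\<in>J. (if x = a then f a else 1) * f x ^ count_list xs x)"
    by (intro prod.cong) auto
  also have "\<dots> = f a * (\<Prod>x\<in>J. f x ^ count_list xs x)"
    using Cons.prems by (simp add: prod.distrib)
  finally show ?case using Cons by simp
qed simp

text \<open>The equation for the summation variable stands last, so that nested sums collapse from
  the innermost variable outwards.\<close>

lemma sum_delta_conj:
  assumes "finite J" "c \<in> J"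
  shows "(\<Sum>d\<in>J. if P \<and> c = d then g d else 0) = (if P then g c else (0 :: 'b :: comm_monoid_add))"
  using assms by (cases P) auto

lemma mult_if_zero: "w * (if P then x else 0) = (if P then x * w else (0 :: 'b :: comm_semiring_0))"
  by (simp add: mult.commute)

text \<open>Domination by \<open>1 + X ^ 4\<close>: the constant dominates where X is at most 1 in
  absolute value, the fourth power elsewhere.\<close>

lemma (in prob_space) integrable_power_le_4:
  fixes X :: "'a \<Rightarrow> real"
  assumes [measurable]: "random_variable borel X" and "integrable M (\<lambda>\<omega>. X \<omega> ^ 4)" "n \<le> 4"
  shows "integrable M (\<lambda>\<omega>. X \<omega> ^ n)"
proof (rule Bochner_Integration.integrable_bound)
  show "integrable M (\<lambda>\<omega>. 1 + X \<omega> ^ 4)" using assms by simp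
  have "\<bar>x\<bar> ^ n \<le> 1 + x ^ 4" for x :: real
    using power_increasing[of n 4 "\<bar>x\<bar>"] power_le_one[of "\<bar>x\<bar>" n] \<open>n \<le> 4\<close>
      zero_le_even_power[of 4 x]
    by (cases "\<bar>x\<bar> \<le> 1") (auto simp: power_even_abs intro: order_trans)
  then show "AE \<omega> in M. norm (X \<omega> ^ n) \<le> norm (1 + X \<omega> ^ 4)"
    by (intro AE_I2) (simp add: power_abs)
qed simp

text \<open>\<open>\<eta>\<close> is the fourth cumulant. Splitting off
  \<open>3 * (v a)\<^sup>2\<close> allows fourth moments to be written as a sum of overlapping
  cases: on the full diagonal all three pairings hold at once and restore this amount.\<close>

locale centered_indep_family = prob_space +
  fixes J :: "'i set" and \<xi> :: "'i \<Rightarrow> 'a \<Rightarrow> real" and v \<tau> \<eta> :: "'i \<Rightarrow> real"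
  assumes fin: "finite J"
    and indep: "indep_vars (\<lambda>_. borel) \<xi> J"
    and integrable4: "\<And>a. a \<in> J \<Longrightarrow> integrable M (\<lambda>\<omega>. \<xi> a \<omega> ^ 4)"
    and mean: "\<And>a. a \<in> J \<Longrightarrow> expectation (\<xi> a) = 0"
    and second: "\<And>a. a \<in> J \<Longrightarrow> expectation (\<lambda>\<omega>. \<xi> a \<omega> ^ 2) = v a"
    and third: "\<And>a. a \<in> J \<Longrightarrow> expectation (\<lambda>\<omega>. \<xi> a \<omega> ^ 3) = \<tau> a"
    and fourth: "\<And>a. a \<in> J \<Longrightarrow> expectation (\<lambda>\<omega>. \<xi> a \<omega> ^ 4) = \<eta> a + 3 * (v a)\<^sup>2"
begin

text \<open>No exponent exceeds the length of the list, so integrable fourth powers cover every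
  power that occurs.\<close>

lemma monomial:
  assumes "set xs \<subseteq> J" "length xs \<le> 4"
  shows "integrable M (\<lambda>\<omega>. \<Prod>x\<leftarrow>xs. \<xi> x \<omega>)"
    and "expectation (\<lambda>\<omega>. \<Prod>x\<leftarrow>xs. \<xi> x \<omega>) =
      (\<Prod>x\<in>set xs. expectation (\<lambda>\<omega>. \<xi> x \<omega> ^ count_list xs x))"
proof -
  have eq: "(\<Prod>x\<leftarrow>xs. \<xi> x \<omega>) = (\<Prod>x\<in>J. \<xi> x \<omega> ^ count_list xs x)" for \<omega>
    by (rule prod_list_map_eq_prod_count_list) (use assms fin in auto)
  have ind: "indep_vars (\<lambda>_. borel) (\<lambda>x \<omega>. \<xi> x \<omega> ^ count_list xs x) J"
    by (rule indep_vars_compose2[OF indep]) simp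
  have int: "integrable M (\<lambda>\<omega>. \<xi> x \<omega> ^ count_list xs x)" if "x \<in> J" for x
  proof (rule integrable_power_le_4)
    show "random_variable borel (\<xi> x)" using indep that by (auto simp: indep_vars_def2)
    show "count_list xs x \<le> 4" using count_le_length[of xs x] assms by simp
  qed (rule integrable4[OF that])
  show "integrable M (\<lambda>\<omega>. \<Prod>x\<leftarrow>xs. \<xi> x \<omega>)"
    unfolding eq by (rule indep_vars_integrable[OF fin ind int])
  have "expectation (\<lambda>\<omega>. \<Prod>x\<leftarrow>xs. \<xi> x \<omega>) =
      (\<Prod>x\<in>J. expectation (\<lambda>\<omega>. \<xi> x \<omega> ^ count_list xs x))"
    unfolding eq by (rule indep_vars_lebesgue_integral[OF fin ind int])
  \<comment> \<open>An absent index has exponent 0, and its factor is the expectation of 1.\<close>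
  also have "\<dots> = (\<Prod>x\<in>set xs. expectation (\<lambda>\<omega>. \<xi> x \<omega> ^ count_list xs x))"
    by (rule prod.mono_neutral_right)
      (use assms fin in \<open>auto simp: count_list_0_iff[THEN iffD2] prob_space\<close>)
  finally show "expectation (\<lambda>\<omega>. \<Prod>x\<leftarrow>xs. \<xi> x \<omega>) =
      (\<Prod>x\<in>set xs. expectation (\<lambda>\<omega>. \<xi> x \<omega> ^ count_list xs x))" .
qed

lemma moment2:
  assumes "a \<in> J" "b \<in> J"
  shows "integrable M (\<lambda>\<omega>. \<xi> a \<omega> * \<xi> b \<omega>)"
    and "expectation (\<lambda>\<omega>. \<xi> a \<omega> * \<xi> b \<omega>) = (if a = b then v a else 0)"
  using monomial[of "[a, b]"] assms mean second
  by (auto simp: numeral_2_eq_2)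

text \<open>An index that occurs exactly once contributes its zero mean, and three positions cannot
  be grouped without such an index unless all three agree.\<close>

lemma moment3:
  assumes "a \<in> J" "b \<in> J" "c \<in> J"
  shows "integrable M (\<lambda>\<omega>. \<xi> a \<omega> * \<xi> b \<omega> * \<xi> c \<omega>)"
    and "expectation (\<lambda>\<omega>. \<xi> a \<omega> * \<xi> b \<omega> * \<xi> c \<omega>) = (if a = b \<and> b = c then \<tau> a else 0)"
proof -
  have eq: "(\<Prod>x\<leftarrow>[a, b, c]. \<xi> x \<omega>) = \<xi> a \<omega> * \<xi> b \<omega> * \<xi> c \<omega>" for \<omega>
    by simp
  show "integrable M (\<lambda>\<omega>. \<xi> a \<omega> * \<xi> b \<omega> * \<xi> c \<omega>)"
    using monomial(1)[of "[a, b, c]"] assms unfolding eq by simp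
  have "expectation (\<lambda>\<omega>. \<xi> a \<omega> * \<xi> b \<omega> * \<xi> c \<omega>) =
      (\<Prod>x\<in>set [a, b, c]. expectation (\<lambda>\<omega>. \<xi> x \<omega> ^ count_list [a, b, c] x))"
    using monomial(2)[of "[a, b, c]"] assms unfolding eq by simp
  also have "\<dots> = (if a = b \<and> b = c then \<tau> a else 0)"
    using assms mean third
    by (cases "a = b"; cases "a = c"; cases "b = c") (auto simp: eval_nat_numeral)
  finally show "expectation (\<lambda>\<omega>. \<xi> a \<omega> * \<xi> b \<omega> * \<xi> c \<omega>) = (if a = b \<and> b = c then \<tau> a else 0)" .
qed

text \<open>A nonzero expectation needs every index at least twice, hence a pairing. Two different
  pairings hold together only if all four indices agree; there the three of them and
  \<open>\<eta> a\<close> add up to the fourth moment.\<close>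

lemma moment4:
  assumes "a \<in> J" "b \<in> J" "c \<in> J" "d \<in> J"
  shows "integrable M (\<lambda>\<omega>. \<xi> a \<omega> * \<xi> b \<omega> * \<xi> c \<omega> * \<xi> d \<omega>)"
    and "expectation (\<lambda>\<omega>. \<xi> a \<omega> * \<xi> b \<omega> * \<xi> c \<omega> * \<xi> d \<omega>) =
      (if a = b \<and> b = c \<and> c = d then \<eta> a else 0) +
      (if a = b \<and> c = d then v a * v c else 0) +
      (if a = c \<and> b = d then v a * v b else 0) +
      (if a = d \<and> b = c then v a * v b else 0)"
proof -
  have eq: "(\<Prod>x\<leftarrow>[a, b, c, d]. \<xi> x \<omega>) = \<xi> a \<omega> * \<xi> b \<omega> * \<xi> c \<omega> * \<xi> d \<omega>" for \<omega>
    by (simp add: mult.assoc)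
  show "integrable M (\<lambda>\<omega>. \<xi> a \<omega> * \<xi> b \<omega> * \<xi> c \<omega> * \<xi> d \<omega>)"
    using monomial(1)[of "[a, b, c, d]"] assms unfolding eq by simp
  have "expectation (\<lambda>\<omega>. \<xi> a \<omega> * \<xi> b \<omega> * \<xi> c \<omega> * \<xi> d \<omega>) =
      (\<Prod>x\<in>set [a, b, c, d]. expectation (\<lambda>\<omega>. \<xi> x \<omega> ^ count_list [a, b, c, d] x))"
    using monomial(2)[of "[a, b, c, d]"] assms unfolding eq by simp
  also have "\<dots> = (if a = b \<and> b = c \<and> c = d then \<eta> a else 0) +
      (if a = b \<and> c = d then v a * v c else 0) +
      (if a = c \<and> b = d then v a * v b else 0) +
      (if a = d \<and> b = c then v a * v b else 0)"
    using assms mean second fourth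
    by (cases "a = b"; cases "a = c"; cases "a = d"; cases "b = c"; cases "b = d"; cases "c = d")
      (auto simp: eval_nat_numeral insert_commute)
  finally show "expectation (\<lambda>\<omega>. \<xi> a \<omega> * \<xi> b \<omega> * \<xi> c \<omega> * \<xi> d \<omega>) =
      (if a = b \<and> b = c \<and> c = d then \<eta> a else 0) +
      (if a = b \<and> c = d then v a * v c else 0) +
      (if a = c \<and> b = d then v a * v b else 0) +
      (if a = d \<and> b = c then v a * v b else 0)" .
qed

definition lin :: "('i \<Rightarrow> real) \<Rightarrow> 'a \<Rightarrow> real" where
  "lin w \<omega> = (\<Sum>a\<in>J. w a * \<xi> a \<omega>)"

lemma expectation_lin: "integrable M (lin w)" "expectation (lin w) = 0"
proof -
  have "integrable M (\<xi> a)" if "a \<in> J" for a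
    using monomial(1)[of "[a]"] that by simp
  then show "integrable M (lin w)" "expectation (lin w) = 0"
    by (simp_all add: lin_def[abs_def] mean)
qed

lemma expectation_lin2:
  shows "integrable M (\<lambda>\<omega>. lin w1 \<omega> * lin w2 \<omega>)"
    and "expectation (\<lambda>\<omega>. lin w1 \<omega> * lin w2 \<omega>) = (\<Sum>a\<in>J. v a * (w1 a * w2 a))"
proof -
  have eq: "lin w1 \<omega> * lin w2 \<omega> = (\<Sum>a\<in>J. \<Sum>b\<in>J. (w1 a * w2 b) * (\<xi> a \<omega> * \<xi> b \<omega>))" for \<omega>
    by (simp add: lin_def sum_product mult_ac)
  show "integrable M (\<lambda>\<omega>. lin w1 \<omega> * lin w2 \<omega>)"
    unfolding eq by (intro Bochner_Integration.integrable_sum integrable_mult_right moment2)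
  have "expectation (\<lambda>\<omega>. lin w1 \<omega> * lin w2 \<omega>) =
      (\<Sum>a\<in>J. \<Sum>b\<in>J. (w1 a * w2 b) * (if a = b then v a else 0))"
    unfolding eq by (simp add: moment2)
  also have "\<dots> = (\<Sum>a\<in>J. v a * (w1 a * w2 a))"
    using fin by (simp add: if_distrib mult_ac cong: if_cong)
  finally show "expectation (\<lambda>\<omega>. lin w1 \<omega> * lin w2 \<omega>) = (\<Sum>a\<in>J. v a * (w1 a * w2 a))" .
qed

lemma expectation_lin3:
  shows "integrable M (\<lambda>\<omega>. lin w1 \<omega> * lin w2 \<omega> * lin w3 \<omega>)"
    and "expectation (\<lambda>\<omega>. lin w1 \<omega> * lin w2 \<omega> * lin w3 \<omega>) =
      (\<Sum>a\<in>J. \<tau> a * (w1 a * w2 a * w3 a))"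
proof -
  have eq: "lin w1 \<omega> * lin w2 \<omega> * lin w3 \<omega> =
      (\<Sum>a\<in>J. \<Sum>b\<in>J. \<Sum>c\<in>J. (w1 a * w2 b * w3 c) * (\<xi> a \<omega> * \<xi> b \<omega> * \<xi> c \<omega>))" for \<omega>
    by (simp only: lin_def mult.assoc sum_distrib_right, simp only: sum_distrib_left mult.assoc)
      (simp only: mult_ac)
  show "integrable M (\<lambda>\<omega>. lin w1 \<omega> * lin w2 \<omega> * lin w3 \<omega>)"
    unfolding eq by (intro Bochner_Integration.integrable_sum integrable_mult_right moment3)
  have "expectation (\<lambda>\<omega>. lin w1 \<omega> * lin w2 \<omega> * lin w3 \<omega>) =
      (\<Sum>a\<in>J. \<Sum>b\<in>J. \<Sum>c\<in>J. (w1 a * w2 b * w3 c) * (if a = b \<and> b = c then \<tau> a else 0))"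
    unfolding eq by (simp add: moment3)
  also have "\<dots> = (\<Sum>a\<in>J. \<Sum>b\<in>J. \<Sum>c\<in>J. if a = b \<and> b = c then \<tau> a * (w1 a * w2 b * w3 c) else 0)"
    by (intro sum.cong refl) auto
  also have "\<dots> = (\<Sum>a\<in>J. \<tau> a * (w1 a * w2 a * w3 a))"
    using fin by (simp add: sum_delta_conj cong: sum.cong)
  finally show "expectation (\<lambda>\<omega>. lin w1 \<omega> * lin w2 \<omega> * lin w3 \<omega>) =
      (\<Sum>a\<in>J. \<tau> a * (w1 a * w2 a * w3 a))" .
qed

lemma expectation_lin4:
  shows "integrable M (\<lambda>\<omega>. lin w1 \<omega> * lin w2 \<omega> * lin w3 \<omega> * lin w4 \<omega>)"
    and "expectation (\<lambda>\<omega>. lin w1 \<omega> * lin w2 \<omega> * lin w3 \<omega> * lin w4 \<omega>) =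
      (\<Sum>a\<in>J. \<eta> a * (w1 a * w2 a * w3 a * w4 a)) +
      (\<Sum>a\<in>J. v a * (w1 a * w2 a)) * (\<Sum>a\<in>J. v a * (w3 a * w4 a)) +
      (\<Sum>a\<in>J. v a * (w1 a * w3 a)) * (\<Sum>a\<in>J. v a * (w2 a * w4 a)) +
      (\<Sum>a\<in>J. v a * (w1 a * w4 a)) * (\<Sum>a\<in>J. v a * (w2 a * w3 a))"
proof -
  have eq: "lin w1 \<omega> * lin w2 \<omega> * lin w3 \<omega> * lin w4 \<omega> =
      (\<Sum>a\<in>J. \<Sum>b\<in>J. \<Sum>c\<in>J. \<Sum>d\<in>J. (w1 a * w2 b * w3 c * w4 d) *
        (\<xi> a \<omega> * \<xi> b \<omega> * \<xi> c \<omega> * \<xi> d \<omega>))" for \<omega>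
    by (simp only: lin_def mult.assoc sum_distrib_right, simp only: sum_distrib_left mult.assoc)
      (simp only: mult_ac)
  show "integrable M (\<lambda>\<omega>. lin w1 \<omega> * lin w2 \<omega> * lin w3 \<omega> * lin w4 \<omega>)"
    unfolding eq by (intro Bochner_Integration.integrable_sum integrable_mult_right moment4)
  let ?w = "\<lambda>a b c d. w1 a * w2 b * w3 c * w4 d"
  have "expectation (\<lambda>\<omega>. lin w1 \<omega> * lin w2 \<omega> * lin w3 \<omega> * lin w4 \<omega>) =
      (\<Sum>a\<in>J. \<Sum>b\<in>J. \<Sum>c\<in>J. \<Sum>d\<in>J. ?w a b c d * expectation (\<lambda>\<omega>. \<xi> a \<omega> * \<xi> b \<omega> * \<xi> c \<omega> * \<xi> d \<omega>))"
    unfolding eq by (simp add: moment4(1))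
  \<comment> \<open>The conditions are regrouped so that an equation for the innermost variable
    \<open>d\<close> always stands last.\<close>
  also have "\<dots> = (\<Sum>a\<in>J. \<Sum>b\<in>J. \<Sum>c\<in>J. \<Sum>d\<in>J.
      (if (a = b \<and> b = c) \<and> c = d then \<eta> a * ?w a b c d else 0) +
      (if a = b \<and> c = d then v a * v c * ?w a b c d else 0) +
      (if a = c \<and> b = d then v a * v b * ?w a b c d else 0) +
      (if b = c \<and> a = d then v a * v b * ?w a b c d else 0))"
    by (intro sum.cong refl, simp only: moment4(2) distrib_left mult_if_zero) (simp only: conj_ac)
  also have "\<dots> = (\<Sum>a\<in>J. \<Sum>b\<in>J. \<Sum>c\<in>J. \<Sum>d\<in>J.
        if (a = b \<and> b = c) \<and> c = d then \<eta> a * ?w a b c d else 0) +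
      (\<Sum>a\<in>J. \<Sum>b\<in>J. \<Sum>c\<in>J. \<Sum>d\<in>J. if a = b \<and> c = d then v a * v c * ?w a b c d else 0) +
      (\<Sum>a\<in>J. \<Sum>b\<in>J. \<Sum>c\<in>J. \<Sum>d\<in>J. if a = c \<and> b = d then v a * v b * ?w a b c d else 0) +
      (\<Sum>a\<in>J. \<Sum>b\<in>J. \<Sum>c\<in>J. \<Sum>d\<in>J. if b = c \<and> a = d then v a * v b * ?w a b c d else 0)"
    by (simp only: sum.distrib)
  also have "(\<Sum>a\<in>J. \<Sum>b\<in>J. \<Sum>c\<in>J. \<Sum>d\<in>J.
        if (a = b \<and> b = c) \<and> c = d then \<eta> a * ?w a b c d else 0) =
      (\<Sum>a\<in>J. \<eta> a * ?w a a a a)"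
    using fin by (simp add: sum_delta_conj del: conj_assoc cong: sum.cong)
  also have "(\<Sum>a\<in>J. \<Sum>b\<in>J. \<Sum>c\<in>J. \<Sum>d\<in>J. if a = b \<and> c = d then v a * v c * ?w a b c d else 0) =
      (\<Sum>a\<in>J. \<Sum>c\<in>J. v a * v c * ?w a a c c)"
  proof (rule sum.cong[OF refl])
    fix a assume "a \<in> J"
    \<comment> \<open>Once \<open>d\<close> is collapsed, the remaining condition
      \<open>a = b\<close> does not mention the next variable \<open>c\<close>. It is moved out of
      the sum over \<open>c\<close> so that \<open>b\<close> can be collapsed.\<close>
    have "(\<Sum>b\<in>J. \<Sum>c\<in>J. \<Sum>d\<in>J. if a = b \<and> c = d then v a * v c * ?w a b c d else 0) =
        (\<Sum>b\<in>J. if a = b then \<Sum>c\<in>J. v a * v c * ?w a b c c else 0)"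
      using fin by (intro sum.cong refl) (auto simp: sum_delta_conj intro!: sum.cong)
    then show "(\<Sum>b\<in>J. \<Sum>c\<in>J. \<Sum>d\<in>J. if a = b \<and> c = d then v a * v c * ?w a b c d else 0) =
        (\<Sum>c\<in>J. v a * v c * ?w a a c c)"
      using fin \<open>a \<in> J\<close> by simp
  qed
  also have "\<dots> = (\<Sum>a\<in>J. v a * (w1 a * w2 a)) * (\<Sum>a\<in>J. v a * (w3 a * w4 a))"
    by (simp add: sum_product mult_ac)
  also have "(\<Sum>a\<in>J. \<Sum>b\<in>J. \<Sum>c\<in>J. \<Sum>d\<in>J. if a = c \<and> b = d then v a * v b * ?w a b c d else 0) =
      (\<Sum>a\<in>J. \<Sum>b\<in>J. v a * v b * ?w a b a b)"
    using fin by (simp add: sum_delta_conj cong: sum.cong)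
  also have "\<dots> = (\<Sum>a\<in>J. v a * (w1 a * w3 a)) * (\<Sum>a\<in>J. v a * (w2 a * w4 a))"
    by (simp add: sum_product mult_ac)
  also have "(\<Sum>a\<in>J. \<Sum>b\<in>J. \<Sum>c\<in>J. \<Sum>d\<in>J. if b = c \<and> a = d then v a * v b * ?w a b c d else 0) =
      (\<Sum>a\<in>J. \<Sum>b\<in>J. v a * v b * ?w a b b a)"
    using fin by (simp add: sum_delta_conj cong: sum.cong)
  also have "\<dots> = (\<Sum>a\<in>J. v a * (w1 a * w4 a)) * (\<Sum>a\<in>J. v a * (w2 a * w3 a))"
    by (simp add: sum_product mult_ac)
  finally show "expectation (\<lambda>\<omega>. lin w1 \<omega> * lin w2 \<omega> * lin w3 \<omega> * lin w4 \<omega>) =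
      (\<Sum>a\<in>J. \<eta> a * (w1 a * w2 a * w3 a * w4 a)) +
      (\<Sum>a\<in>J. v a * (w1 a * w2 a)) * (\<Sum>a\<in>J. v a * (w3 a * w4 a)) +
      (\<Sum>a\<in>J. v a * (w1 a * w3 a)) * (\<Sum>a\<in>J. v a * (w2 a * w4 a)) +
      (\<Sum>a\<in>J. v a * (w1 a * w4 a)) * (\<Sum>a\<in>J. v a * (w2 a * w3 a))" .
qed

end

section \<open>Derivatives of determinants and inverses\<close>

lemma permutes_atLeast0LessThan_less:
  fixes n :: nat
  shows "p permutes {0..<n} \<Longrightarrow> i < n \<Longrightarrow> p i < n"
  using permutes_in_image[of p "{0..<n}" i] by simp

lemma smult_mat_mult_vec:
  assumes "A \<in> carrier_mat n m" "x \<in> carrier_vec m"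
  shows "(c \<cdot>\<^sub>m A) *\<^sub>v x = c \<cdot>\<^sub>v (A *\<^sub>v (x :: real vec))"
  using assms by (intro eq_vecI) (auto simp: scalar_prod_def sum_distrib_left mult_ac)

lemma scalar_prod_self_pos:
  assumes "x \<in> carrier_vec n" "x \<noteq> 0\<^sub>v n"
  shows "x \<bullet> x > (0 :: real)"
proof -
  obtain i where "i < n" "x $ i \<noteq> 0" using assms by (auto simp: vec_eq_iff)
  then have "i < n" "x $ i * x $ i > 0" by (simp_all add: zero_less_mult_iff linorder_neq_iff disj_commute)
  then show ?thesis
    using assms(1) by (auto simp: scalar_prod_def intro!: sum_pos2[of _ i])
qed

section \<open>Continuity of determinant, adjugate and inverse\<close>

lemma isCont_eventually_nhds_ne:
  fixes f :: "real \<Rightarrow> real"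
  assumes "isCont f z" "f z \<noteq> 0"
  shows "eventually (\<lambda>h. f h \<noteq> 0) (nhds z)"
  using assms tendsto_imp_eventually_ne[of f "f z" "at z" 0]
  by (auto simp: isCont_def eventually_nhds_conv_at)

lemma isCont_det:
  fixes A :: "real \<Rightarrow> real mat"
  assumes "\<And>h. A h \<in> carrier_mat n n"
    and "\<And>i j. i < n \<Longrightarrow> j < n \<Longrightarrow> isCont (\<lambda>h. A h $$ (i, j)) z"
  shows "isCont (\<lambda>h. det (A h)) z"
  unfolding det_def'[OF assms(1)]
  by (intro continuous_intros assms(2)) (auto simp: permutes_atLeast0LessThan_less)

lemma isCont_adj_mat:
  fixes A :: "real \<Rightarrow> real mat"
  assumes A: "\<And>h. A h \<in> carrier_mat n n"
    and cont: "\<And>i j. i < n \<Longrightarrow> j < n \<Longrightarrow> isCont (\<lambda>h. A h $$ (i, j)) z"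
    and ij: "i < n" "j < n"
  shows "isCont (\<lambda>h. adj_mat (A h) $$ (i, j)) z"
proof -
  have dims: "dim_row (A h) = n" "dim_col (A h) = n" for h using A by auto
  have "isCont (\<lambda>h. det (mat_delete (A h) j i)) z"
  proof (rule isCont_det)
    show "mat_delete (A h) j i \<in> carrier_mat (n - 1) (n - 1)" for h
      using mat_delete_carrier[OF A] .
    show "isCont (\<lambda>h. mat_delete (A h) j i $$ (i', j')) z" if "i' < n - 1" "j' < n - 1" for i' j'
      using that by (auto simp: mat_delete_def dims intro!: cont)
  qed
  then show ?thesis
    using ij by (auto simp: adj_mat_def dims cofactor_def intro!: continuous_intros)
qed

text \<open>\<open>mat_inverse\<close> is option-valued, so \<open>mat_inv\<close> has its intended
  meaning only once \<open>None\<close> is excluded; the nonzero determinant does this.\<close>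

lemma mat_inv:
  assumes "A \<in> carrier_mat n n" "det A \<noteq> 0"
  shows "mat_inv A \<in> carrier_mat n n" "A * mat_inv A = 1\<^sub>m n" "mat_inv A * A = 1\<^sub>m n"
proof -
  have "mat_inverse A \<noteq> None"
    using mat_inverse(1)[OF assms(1), where b = "()"] det_non_zero_imp_unit[OF assms, where b = "()"]
    by blast
  then have "A * mat_inv A = 1\<^sub>m n \<and> mat_inv A * A = 1\<^sub>m n \<and> mat_inv A \<in> carrier_mat n n"
    using mat_inverse(2)[OF assms(1)] by (auto simp: mat_inv_def)
  then show "mat_inv A \<in> carrier_mat n n" "A * mat_inv A = 1\<^sub>m n" "mat_inv A * A = 1\<^sub>m n"
    by auto
qed

lemma mat_inv_unique:
  assumes A: "A \<in> carrier_mat n n" "det A \<noteq> 0" and B: "B \<in> carrier_mat n n" "A * B = 1\<^sub>m n"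
  shows "B = mat_inv A"
proof -
  have "B = (mat_inv A * A) * B" using mat_inv[OF A] B by simp
  also have "\<dots> = mat_inv A * (A * B)" using mat_inv[OF A] A B by (intro assoc_mult_mat)
  finally show ?thesis using mat_inv[OF A] B by simp
qed

lemma mat_inv_eq_adj_mat:
  assumes "A \<in> carrier_mat n n" "det A \<noteq> 0"
  shows "mat_inv A = (1 / det A) \<cdot>\<^sub>m adj_mat A"
proof (rule mat_inv_unique[OF assms, symmetric])
  show "(1 / det A) \<cdot>\<^sub>m adj_mat A \<in> carrier_mat n n" using adj_mat[OF assms(1)] by simp
  have "A * ((1 / det A) \<cdot>\<^sub>m adj_mat A) = (1 / det A) \<cdot>\<^sub>m (A * adj_mat A)"
    using assms(1) adj_mat(1)[OF assms(1)] by (rule mult_smult_distrib)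
  also have "\<dots> = 1\<^sub>m n"
    using assms(2) by (auto simp: adj_mat(2)[OF assms(1)] intro!: eq_matI)
  finally show "A * ((1 / det A) \<cdot>\<^sub>m adj_mat A) = 1\<^sub>m n" .
qed

text \<open>The adjugate formula is continuous but agrees with the inverse only where the
  determinant is nonzero. This is the case in a neighbourhood of \<open>z\<close>, which is enough
  for continuity at \<open>z\<close>.\<close>

lemma isCont_mat_inv:
  fixes A :: "real \<Rightarrow> real mat"
  assumes A: "\<And>h. A h \<in> carrier_mat n n"
    and cont: "\<And>i j. i < n \<Longrightarrow> j < n \<Longrightarrow> isCont (\<lambda>h. A h $$ (i, j)) z"
    and det: "det (A z) \<noteq> 0" and ij: "i < n" "j < n"
  shows "isCont (\<lambda>h. mat_inv (A h) $$ (i, j)) z"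
proof -
  have "isCont (\<lambda>h. 1 / det (A h) * adj_mat (A h) $$ (i, j)) z"
    using det by (intro continuous_intros isCont_det[OF A] isCont_adj_mat[OF A] cont ij) auto
  moreover have "eventually (\<lambda>h. det (A h) \<noteq> 0) (nhds z)"
    using isCont_eventually_nhds_ne[OF isCont_det[OF A cont] det] .
  then have "eventually (\<lambda>h. 1 / det (A h) * adj_mat (A h) $$ (i, j) = mat_inv (A h) $$ (i, j)) (nhds z)"
    by eventually_elim (use carrier_matD[OF adj_mat(1)[OF A]] ij in \<open>simp add: mat_inv_eq_adj_mat[OF A]\<close>)
  ultimately show ?thesis
    using isCont_cong by fast
qed

lemma mat_quad_sum:
  assumes "B \<in> carrier_mat n n" "x \<in> carrier_vec n" "y \<in> carrier_vec n"
  shows "x \<bullet> (B *\<^sub>v y) = (\<Sum>i<n. \<Sum>j<n. x $ i * B $$ (i, j) * y $ j)"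
  using assms
  by (auto simp: scalar_prod_def sum_distrib_left mult_ac atLeast0LessThan intro!: sum.cong)

lemma mat_mult_sum:
  assumes "A \<in> carrier_mat n m" "B \<in> carrier_mat m q" "i < n" "j < q"
  shows "(A * B) $$ (i, j) = (\<Sum>k<m. A $$ (i, k) * B $$ (k, j))"
  using assms by (auto simp: scalar_prod_def atLeast0LessThan intro!: sum.cong)

section \<open>First-order perturbation of determinants and of quadratic forms in the
  inverse\<close>

text \<open>Jacobi's formula at the identity. Differentiating a Leibniz term replaces one factor by
  its slope and leaves entries of the identity as the others. A permutation other than
  \<open>id\<close> moves at least two points, so an off-diagonal zero always survives.\<close>

lemma DERIV_det_one:
  assumes B: "(B :: real mat) \<in> carrier_mat n n"
  shows "((\<lambda>h. det (1\<^sub>m n + h \<cdot>\<^sub>m B)) has_field_derivative mat_trace B) (at 0)"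
proof -
  let ?P = "{p. p permutes {0..<n}}"
  let ?e = "\<lambda>i j. if i = j then 1 else (0 :: real)"
  have det_eq: "det (1\<^sub>m n + h \<cdot>\<^sub>m B) =
      (\<Sum>p\<in>?P. signof p * (\<Prod>i\<in>{0..<n}. ?e i (p i) + h * B $$ (i, p i)))" for h
    using B by (subst det_def'[of _ n]) (auto simp: permutes_atLeast0LessThan_less intro!: sum.cong prod.cong)
  let ?D = "\<lambda>p. \<Sum>i\<in>{0..<n}. B $$ (i, p i) * (\<Prod>j\<in>{0..<n} - {i}. ?e j (p j))"
  have "((\<lambda>h. \<Prod>i\<in>{0..<n}. ?e i (p i) + h * B $$ (i, p i)) has_field_derivative ?D p) (at 0)" for p
    by (rule DERIV_cong[OF has_field_derivative_prod]) (auto intro!: derivative_eq_intros)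
  then have deriv: "((\<lambda>h. det (1\<^sub>m n + h \<cdot>\<^sub>m B)) has_field_derivative
      (\<Sum>p\<in>?P. signof p * ?D p)) (at 0)"
    unfolding det_eq by (intro DERIV_sum DERIV_cmult)
  have "signof p * ?D p = 0" if p: "p \<in> ?P" "p \<noteq> id" for p
  proof -
    have zero: "(\<Prod>j\<in>{0..<n} - {i}. ?e j (p j)) = 0" if "i < n" for i
    proof -
      obtain k where k: "p k \<noteq> k" using p by fastforce
      \<comment> \<open>Both \<open>k\<close> and \<open>p k\<close> are moved, so whichever index
        \<open>i\<close> is removed, one of them still gives a vanishing factor.\<close>
      have "p (p k) \<noteq> p k" using k p permutes_inj[of p] by (auto dest: injD)
      moreover have "k < n" "p k < n"
        using k p permutes_not_in[of p "{0..<n}" k] permutes_in_image[of p "{0..<n}" k] by auto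
      ultimately obtain j where "j \<in> {0..<n} - {i}" "p j \<noteq> j"
        using k by (cases "k = i") auto
      then show ?thesis by (intro prod_zero bexI[of _ j]) auto
    qed
    have "?D p = 0" by (intro sum.neutral ballI, subst zero) auto
    then show ?thesis by simp
  qed
  then have "(\<Sum>p\<in>?P. signof p * ?D p) = (\<Sum>p\<in>{id}. signof p * ?D p)"
    by (intro sum.mono_neutral_right) (auto simp: permutes_id finite_permutations)
  also have "\<dots> = mat_trace B"
    using B by (simp add: mat_trace_def atLeast0LessThan)
  finally show ?thesis using deriv by simp
qed

context
  fixes A B :: "real mat" and n :: nat
  assumes A: "A \<in> carrier_mat n n" and B: "B \<in> carrier_mat n n" and det: "det A \<noteq> 0"
begin

text \<open>Pulling out the factor \<open>A\<close> leaves a perturbation of the identity in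
  direction \<open>mat_inv A * B\<close>.\<close>

lemma DERIV_det_affine:
  "((\<lambda>h. det (A + h \<cdot>\<^sub>m B)) has_field_derivative det A * mat_trace (mat_inv A * B)) (at 0)"
proof -
  note W = mat_inv[OF A det]
  have "A + h \<cdot>\<^sub>m B = A * (1\<^sub>m n + h \<cdot>\<^sub>m (mat_inv A * B))" for h
  proof -
    have "A * (1\<^sub>m n + h \<cdot>\<^sub>m (mat_inv A * B)) = A * 1\<^sub>m n + A * (h \<cdot>\<^sub>m (mat_inv A * B))"
      using A W B by (intro mult_add_distrib_mat) auto
    also have "A * (h \<cdot>\<^sub>m (mat_inv A * B)) = h \<cdot>\<^sub>m (A * (mat_inv A * B))"
      using A W B by (intro mult_smult_distrib) auto
    also have "A * (mat_inv A * B) = B"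
      using A W B by (simp flip: assoc_mult_mat)
    finally show ?thesis using A by simp
  qed
  then have "det (A + h \<cdot>\<^sub>m B) = det A * det (1\<^sub>m n + h \<cdot>\<^sub>m (mat_inv A * B))" for h
    using A W B by (simp add: det_mult)
  then show ?thesis
    using DERIV_cmult[OF DERIV_det_one[of "mat_inv A * B" n], of "det A"] A W B by simp
qed

text \<open>
  The resolvent identity expresses the difference quotient through the inverse at \<open>h\<close>, so that
  continuity of the inverse suffices.
\<close>

lemma DERIV_quad_mat_inv_affine:
  assumes x: "x \<in> carrier_vec n"
  shows "((\<lambda>h. x \<bullet> (mat_inv (A + h \<cdot>\<^sub>m B) *\<^sub>v x)) has_field_derivative
    - (x \<bullet> ((mat_inv A * B * mat_inv A) *\<^sub>v x))) (at 0)"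
proof -
  let ?W = "\<lambda>h. mat_inv (A + h \<cdot>\<^sub>m B)"
  let ?G = "\<lambda>h. ?W 0 * B * ?W h"
  let ?g = "\<lambda>h. - (x \<bullet> (?G h *\<^sub>v x))"
  have A0: "A + 0 \<cdot>\<^sub>m B = A" using A B by auto
  have AB: "A + h \<cdot>\<^sub>m B \<in> carrier_mat n n" for h using A B by auto
  have cont: "isCont (\<lambda>h. (A + h \<cdot>\<^sub>m B) $$ (i, j)) 0" if "i < n" "j < n" for i j
    using that A B by (auto intro!: continuous_intros)
  have ev: "eventually (\<lambda>h. det (A + h \<cdot>\<^sub>m B) \<noteq> 0) (nhds 0)"
    using isCont_eventually_nhds_ne[OF isCont_det[OF AB cont]] det by (simp add: A0)
  have W: "?W 0 \<in> carrier_mat n n" "?W 0 * A = 1\<^sub>m n" using mat_inv[OF A det] by (simp_all add: A0)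
  \<comment> \<open>Both facts hold wherever the determinant is nonzero. The second one writes
    \<open>?g\<close> as a finite expression in entries of the inverse, whose continuity is already
    available.\<close>
  have "eventually (\<lambda>h. x \<bullet> (?W h *\<^sub>v x) = x \<bullet> (?W 0 *\<^sub>v x) + h * ?g h \<and> ?g h = - (\<Sum>i<n. \<Sum>j<n. x $ i *
      (\<Sum>k<n. (?W 0 * B) $$ (i, k) * ?W h $$ (k, j)) * x $ j)) (nhds 0)"
    using ev
  proof eventually_elim
    case (elim h)
    note Wh = mat_inv[OF AB elim]
    have Wh': "?W h \<in> carrier_mat n n" "A * ?W h + h \<cdot>\<^sub>m B * ?W h = 1\<^sub>m n"
      using Wh A B add_mult_distrib_mat[of A n n "h \<cdot>\<^sub>m B" "?W h" n] by auto
    have "?W 0 = ?W 0 * (A * ?W h + h \<cdot>\<^sub>m B * ?W h)" using Wh' W by simp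
    also have "\<dots> = ?W 0 * (A * ?W h) + ?W 0 * (h \<cdot>\<^sub>m B * ?W h)"
      using Wh' W A B by (intro mult_add_distrib_mat) auto
    also have "?W 0 * (A * ?W h) = ?W h"
      using Wh' W A by (simp flip: assoc_mult_mat)
    also have "?W 0 * (h \<cdot>\<^sub>m B * ?W h) = h \<cdot>\<^sub>m (?W 0 * B * ?W h)"
      using Wh' W A B by (simp add: mult_smult_assoc_mat[of _ n n _ n] mult_smult_distrib[of _ n n _ n] assoc_mult_mat[of _ n n _ n _ n])
    finally have W0: "?W 0 = ?W h + h \<cdot>\<^sub>m ?G h" .
    have G: "?G h \<in> carrier_mat n n" using W B Wh by auto
    have "x \<bullet> (?W 0 *\<^sub>v x) = x \<bullet> (?W h *\<^sub>v x + h \<cdot>\<^sub>v (?G h *\<^sub>v x))"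
      by (subst W0, subst add_mult_distrib_mat_vec[of _ n n])
        (use Wh G x in \<open>auto simp: smult_mat_mult_vec[of _ n n]\<close>)
    also have "\<dots> = x \<bullet> (?W h *\<^sub>v x) + h * (x \<bullet> (?G h *\<^sub>v x))"
      using Wh(1) G x by (subst scalar_prod_add_distrib[of _ n]) auto
    finally have "x \<bullet> (?W h *\<^sub>v x) = x \<bullet> (?W 0 *\<^sub>v x) + h * ?g h" by simp
    moreover have "?g h = - (\<Sum>i<n. \<Sum>j<n. x $ i *
      (\<Sum>k<n. (?W 0 * B) $$ (i, k) * ?W h $$ (k, j)) * x $ j)"
      unfolding mat_quad_sum[OF G x x]
      using W B Wh
      by (intro arg_cong[where f = uminus] sum.cong refl, subst mat_mult_sum[of _ n n _ n]) auto
    ultimately show ?case by blast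
  qed
  then have ev1: "eventually (\<lambda>h. x \<bullet> (?W h *\<^sub>v x) = x \<bullet> (?W 0 *\<^sub>v x) + h * ?g h) (nhds 0)"
    and ev2: "eventually (\<lambda>h. ?g h = - (\<Sum>i<n. \<Sum>j<n. x $ i *
      (\<Sum>k<n. (?W 0 * B) $$ (i, k) * ?W h $$ (k, j)) * x $ j)) (nhds 0)"
    by (auto elim: eventually_mono)
  have "isCont (\<lambda>h. - (\<Sum>i<n. \<Sum>j<n. x $ i *
      (\<Sum>k<n. (?W 0 * B) $$ (i, k) * ?W h $$ (k, j)) * x $ j)) 0"
    using det by (intro continuous_intros isCont_mat_inv[OF AB cont]) (auto simp: A0)
  then have "isCont ?g 0" using isCont_cong[OF ev2] by blast
  \<comment> \<open>Caratheodory's form of the derivative: the difference quotient at 0 is exactly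
    \<open>?g h\<close>, and it tends to \<open>?g 0\<close> by continuity.\<close>
  then have "((\<lambda>h. x \<bullet> (?W 0 *\<^sub>v x) + h * ?g h) has_field_derivative ?g 0) (at 0)"
    unfolding has_field_derivative_iff isCont_def
    by (rule Lim_transform_eventually) (auto simp: eventually_at_filter)
  then have "((\<lambda>h. x \<bullet> (?W h *\<^sub>v x)) has_field_derivative ?g 0) (at 0)"
    using DERIV_cong_ev[OF refl ev1 refl] by blast
  then show ?thesis by (simp add: A0)
qed

end

text \<open>The segment from the identity to \<open>A\<close> consists of positive definite
  matrices, so the determinant has no zero on it. Starting from 1, it cannot become nonpositive by
  the intermediate value theorem.\<close>

lemma det_pos_if_pos_def:
  assumes A: "(A :: real mat) \<in> carrier_mat n n"
    and pos: "\<And>x. x \<in> carrier_vec n \<Longrightarrow> x \<noteq> 0\<^sub>v n \<Longrightarrow> x \<bullet> (A *\<^sub>v x) > 0"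
  shows "det A > 0"
proof (rule ccontr)
  assume neg: "\<not> det A > 0"
  define F where "F r = (1 - r) \<cdot>\<^sub>m 1\<^sub>m n + r \<cdot>\<^sub>m A" for r :: real
  have F: "F r \<in> carrier_mat n n" for r using A by (simp add: F_def)
  have "isCont (\<lambda>r. det (F r)) z" for z
    by (rule isCont_det[OF F]) (use A in \<open>auto simp: F_def intro!: continuous_intros\<close>)
  moreover have "F 0 = 1\<^sub>m n" "F 1 = A" using A by (auto simp: F_def)
  ultimately obtain r where r: "0 \<le> r" "r \<le> 1" "det (F r) = 0"
    using IVT2[of "\<lambda>r. det (F r)" 1 0 0] neg by auto
  then obtain x where x: "x \<in> carrier_vec n" "x \<noteq> 0\<^sub>v n" "F r *\<^sub>v x = 0\<^sub>v n"
    using det_0_iff_vec_prod_zero_field[OF F] by blast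
  have "F r *\<^sub>v x = (1 - r) \<cdot>\<^sub>v x + r \<cdot>\<^sub>v (A *\<^sub>v x)"
    unfolding F_def using A x(1)
    by (subst add_mult_distrib_mat_vec[of _ n n]) (auto simp: smult_mat_mult_vec[of _ n n])
  then have "x \<bullet> (F r *\<^sub>v x) = (1 - r) * (x \<bullet> x) + r * (x \<bullet> (A *\<^sub>v x))"
    using A x(1) by (simp add: scalar_prod_add_distrib[of _ n])
  then have zero: "(1 - r) * (x \<bullet> x) + r * (x \<bullet> (A *\<^sub>v x)) = 0" using x by simp
  have "x \<bullet> x > 0" "x \<bullet> (A *\<^sub>v x) > 0"
    using pos[OF x(1,2)] scalar_prod_self_pos[OF x(1,2)] by auto
  then show False using zero r
    by (smt (verit) mult_nonneg_nonneg mult_pos_pos)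
qed

section \<open>Covariance matrix and score\<close>

lemma sum_rotate3:
  "(\<Sum>i\<in>A. \<Sum>j\<in>B. \<Sum>k\<in>D. g i j k) = (\<Sum>k\<in>D. \<Sum>i\<in>A. \<Sum>j\<in>B. g i j k)"
proof -
  have "(\<Sum>i\<in>A. \<Sum>j\<in>B. \<Sum>k\<in>D. g i j k) = (\<Sum>i\<in>A. \<Sum>k\<in>D. \<Sum>j\<in>B. g i j k)"
    by (rule sum.cong[OF refl], rule sum.swap)
  also have "\<dots> = (\<Sum>k\<in>D. \<Sum>i\<in>A. \<Sum>j\<in>B. g i j k)"
    by (rule sum.swap)
  finally show ?thesis .
qed

lemma mult_mat_unit_vec:
  assumes "(X :: real mat) \<in> carrier_mat n p" "j < p"
  shows "X *\<^sub>v unit_vec p j = col X j"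
  using assms by (intro eq_vecI) auto

locale mixed_design =
  fixes N s :: nat and m :: "nat \<Rightarrow> nat" and Z :: "nat \<Rightarrow> real mat"
    and \<sigma> :: "nat \<Rightarrow> real" and \<theta> :: "real vec"
  assumes Z_dim: "\<And>t. t \<le> s \<Longrightarrow> Z t \<in> carrier_mat N (m t)"
    and m0: "m 0 = N" and Z0: "Z 0 = 1\<^sub>m N"
    and \<sigma>0: "(\<sigma> 0)\<^sup>2 > 0"
    and theta: "\<theta> = vec (s + 1) (\<lambda>t. if t = 0 then (\<sigma> 0)\<^sup>2 else (\<sigma> t)\<^sup>2 / (\<sigma> 0)\<^sup>2)"
begin

abbreviation V where "V \<equiv> cov_mat N s Z \<theta>"
abbreviation W where "W \<equiv> mat_inv V"
abbreviation C where "C \<equiv> Cmat N s Z \<theta>"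

text \<open>The covariance matrix is affine in each single parameter; this is its slope.\<close>

definition slope :: "nat \<Rightarrow> real mat" where
  "slope k = (if k = 0 then (1 / \<theta> $ 0) \<cdot>\<^sub>m V else \<theta> $ 0 \<cdot>\<^sub>m (Z k * transpose_mat (Z k)))"

lemma theta_simps: "\<theta> $ 0 = (\<sigma> 0)\<^sup>2" "t \<le> s \<Longrightarrow> (\<sigma> 0)\<^sup>2 * gam \<theta> t = (\<sigma> t)\<^sup>2"
  "dim_vec \<theta> = s + 1"
  using \<sigma>0 by (auto simp: theta gam_def)

lemma atMost_eq_insert: "{..s} = insert 0 {1..s}"
  by auto

lemma Z_gram_entry:
  assumes "t \<le> s" "i < N" "i' < N"
  shows "(Z t * transpose_mat (Z t)) $$ (i, i') = (\<Sum>l<m t. Z t $$ (i, l) * Z t $$ (i', l))"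
  using assms Z_dim[OF assms(1)] by (subst mat_mult_sum[of _ N "m t" _ N]) auto

lemma sum_gam:
  assumes "i < N" "i' < N"
  shows "(\<sigma> 0)\<^sup>2 * (\<Sum>t\<le>s. gam \<theta> t * (\<Sum>l<m t. Z t $$ (i, l) * Z t $$ (i', l))) =
    (\<Sum>t\<le>s. (\<sigma> t)\<^sup>2 * (\<Sum>l<m t. Z t $$ (i, l) * Z t $$ (i', l)))"
  unfolding sum_distrib_left by (intro sum.cong refl) (simp add: theta_simps flip: mult.assoc)

lemma cov_mat_entry:
  assumes "i < N" "i' < N"
  shows "cov_mat N s Z \<theta>' $$ (i, i') =
    \<theta>' $ 0 * (\<Sum>t\<le>s. gam \<theta>' t * (\<Sum>l<m t. Z t $$ (i, l) * Z t $$ (i', l)))"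
proof -
  have "(\<Sum>l<N. (1\<^sub>m N :: real mat) $$ (i, l) * 1\<^sub>m N $$ (i', l)) = (if i = i' then 1 else 0)"
    using assms by (simp add: if_distrib cong: if_cong)
  then show ?thesis
    using assms Z_dim by (simp add: cov_mat_def atMost_eq_insert Z_gram_entry gam_def Z0 m0)
qed

lemma V_entry:
  assumes "i < N" "i' < N"
  shows "V $$ (i, i') = (\<Sum>t\<le>s. (\<sigma> t)\<^sup>2 * (\<Sum>l<m t. Z t $$ (i, l) * Z t $$ (i', l)))"
  using assms by (simp add: cov_mat_entry sum_gam theta_simps)

text \<open>The bridge between \<Gamma> and second moments: a product of two entries of V is
  \<lambda> squared times the product of the corresponding values of \<Gamma>.\<close>

lemma V_Gam:
  assumes "i < N" "i' < N"
  shows "\<theta> $ 0 * Gam s Z \<theta> i i' = V $$ (i, i')"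
proof -
  have "row (Z t) i \<bullet> row (Z t) i' = (\<Sum>l<m t. Z t $$ (i, l) * Z t $$ (i', l))" if "t \<le> s" for t
    using assms Z_dim[OF that] by (auto simp: scalar_prod_def atLeast0LessThan intro!: sum.cong)
  then show ?thesis
    using assms by (simp add: cov_mat_entry Gam_def)
qed

lemma V_carrier: "cov_mat N s Z \<theta>' \<in> carrier_mat N N"
  by (simp add: cov_mat_def)

lemma V_sym: "transpose_mat V = V"
  using V_carrier[of \<theta>] by (intro eq_matI) (auto simp: V_entry mult.commute)

text \<open>The form is a sum of squares: the scalar products of \<open>x\<close> with the columns
  of \<open>Z t\<close>, weighted by \<open>(\<sigma> t)\<^sup>2\<close>. The error term
  \<open>t = 0\<close> alone already gives \<open>(\<sigma> 0)\<^sup>2\<close> times the squared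
  length of \<open>x\<close>.\<close>

lemma V_pos:
  assumes x: "x \<in> carrier_vec N" "x \<noteq> 0\<^sub>v N"
  shows "x \<bullet> (V *\<^sub>v x) > 0"
proof -
  have "x \<bullet> (V *\<^sub>v x) = (\<Sum>i<N. \<Sum>j<N. \<Sum>t\<le>s. \<Sum>l<m t.
      (\<sigma> t)\<^sup>2 * ((x $ i * Z t $$ (i, l)) * (x $ j * Z t $$ (j, l))))"
    unfolding mat_quad_sum[OF V_carrier x(1) x(1)]
    by (intro sum.cong refl) (simp add: V_entry sum_distrib_left sum_distrib_right mult_ac)
  also have "\<dots> = (\<Sum>t\<le>s. \<Sum>l<m t. \<Sum>i<N. \<Sum>j<N.
      (\<sigma> t)\<^sup>2 * ((x $ i * Z t $$ (i, l)) * (x $ j * Z t $$ (j, l))))"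
    by (subst sum_rotate3, rule sum.cong[OF refl], rule sum_rotate3)
  also have "\<dots> = (\<Sum>t\<le>s. (\<sigma> t)\<^sup>2 * (\<Sum>l<m t. (\<Sum>i<N. x $ i * Z t $$ (i, l))\<^sup>2))"
    by (simp only: power2_eq_square sum_product, simp only: sum_distrib_left)
  also have "\<dots> \<ge> (\<sigma> 0)\<^sup>2 * (\<Sum>l<m 0. (\<Sum>i<N. x $ i * Z 0 $$ (i, l))\<^sup>2)"
    by (rule member_le_sum) (auto intro!: mult_nonneg_nonneg sum_nonneg)
  also have "(\<Sum>l<m 0. (\<Sum>i<N. x $ i * Z 0 $$ (i, l))\<^sup>2) = x \<bullet> x"
    using x by (auto simp: Z0 m0 scalar_prod_def atLeast0LessThan power2_eq_square if_distrib
        cong: if_cong intro!: sum.cong)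
  finally show ?thesis
    using mult_pos_pos[OF \<sigma>0 scalar_prod_self_pos[OF x]] by linarith
qed

lemma det_V: "det V > 0"
  by (rule det_pos_if_pos_def[OF V_carrier V_pos])

lemma W: "W \<in> carrier_mat N N" "V * W = 1\<^sub>m N" "W * V = 1\<^sub>m N"
  using mat_inv[OF V_carrier] det_V by auto

text \<open>The transpose is a right inverse of the symmetric matrix V, and such an inverse is
  unique.\<close>

lemma W_sym: "transpose_mat W = W"
proof (rule mat_inv_unique[OF V_carrier])
  have "V * transpose_mat W = transpose_mat (W * V)"
    using W V_carrier by (subst transpose_mult[of _ N N]) (auto simp: V_sym)
  then show "V * transpose_mat W = 1\<^sub>m N" by (simp add: W)
qed (use W det_V in auto)

lemma slope_carrier: "k \<le> s \<Longrightarrow> slope k \<in> carrier_mat N N"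
  using Z_dim[of k] V_carrier by (auto simp: slope_def)

lemma slope_sym: "k \<le> s \<Longrightarrow> transpose_mat (slope k) = slope k"
  using slope_carrier[of k] V_carrier[of \<theta>] Z_dim[of k]
  by (intro eq_matI) (auto simp: slope_def V_entry Z_gram_entry mult.commute
      simp del: index_mult_mat(1))

text \<open>Puts both cases of \<open>Cmat\<close> into the shape in which the derivative of the
  quadratic form arrives; for \<open>k = 0\<close> the factor V of the slope cancels against one
  inverse.\<close>

lemma C_eq_slope:
  assumes "k \<le> s"
  shows "C k = (1 / 2) \<cdot>\<^sub>m (W * slope k * W)"
proof (cases "k = 0")
  case True
  have "W * slope k * W = (1 / \<theta> $ 0) \<cdot>\<^sub>m (W * V * W)"
    using W V_carrier True
    by (simp add: slope_def mult_smult_assoc_mat[of _ N N _ N] mult_smult_distrib[of _ N N _ N])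
  then show ?thesis
    using True W by (auto simp: Cmat_def Let_def intro!: eq_matI)
next
  case False
  have "W * slope k * W = \<theta> $ 0 \<cdot>\<^sub>m (W * (Z k * transpose_mat (Z k)) * W)"
    using W Z_dim[OF assms] False
    by (simp add: slope_def mult_smult_assoc_mat[of _ N N _ N] mult_smult_distrib[of _ N N _ N])
  also have "W * (Z k * transpose_mat (Z k)) = W * Z k * transpose_mat (Z k)"
    using W Z_dim[OF assms] by (intro assoc_mult_mat[symmetric]) auto
  finally show ?thesis
    using False by (auto simp: Cmat_def Let_def intro!: eq_matI)
qed

lemma C_carrier: "k \<le> s \<Longrightarrow> C k \<in> carrier_mat N N"
  using W(1) slope_carrier[of k] by (simp add: C_eq_slope mult_carrier_mat[of _ N N _ N])

lemma C_sym:
  assumes k: "k \<le> s" and ij: "i < N" "j < N"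
  shows "C k $$ (i, j) = C k $$ (j, i)"
proof -
  let ?G = "W * slope k * W"
  have G: "?G \<in> carrier_mat N N"
    using W(1) slope_carrier[OF k] by (intro mult_carrier_mat)
  have "transpose_mat ?G = W * (slope k * W)"
    using W(1) slope_carrier[OF k]
    by (simp add: transpose_mult[of _ N N _ N] W_sym slope_sym[OF k])
  also have "\<dots> = ?G"
    using W(1) slope_carrier[OF k] by (intro assoc_mult_mat[symmetric])
  finally have "transpose_mat ?G $$ (i, j) = ?G $$ (i, j)" by simp
  moreover have "transpose_mat ?G $$ (i, j) = ?G $$ (j, i)"
    using G ij by (intro index_transpose_mat(1)) (simp_all only: carrier_matD)
  ultimately show ?thesis
    using carrier_matD[OF G] ij
    by (simp only: C_eq_slope[OF k] index_smult_mat)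
qed

text \<open>Moving \<lambda> rescales the whole matrix, and moving one \<gamma> changes a single
  coefficient, so the expansion in \<open>h\<close> is exact and has no remainder.\<close>

lemma cov_mat_shift:
  assumes k: "k \<le> s"
  shows "cov_mat N s Z (\<theta> + h \<cdot>\<^sub>v unit_vec (s + 1) k) = V + h \<cdot>\<^sub>m slope k" (is "cov_mat N s Z ?\<theta> = _")
proof (rule eq_matI)
  fix i j assume "i < dim_row (V + h \<cdot>\<^sub>m slope k)" "j < dim_col (V + h \<cdot>\<^sub>m slope k)"
  then have ij: "i < N" "j < N" using slope_carrier[OF k] by auto
  let ?g = "\<lambda>t. \<Sum>l<m t. Z t $$ (i, l) * Z t $$ (j, l)"
  have rhs: "(V + h \<cdot>\<^sub>m slope k) $$ (i, j) = V $$ (i, j) + h * slope k $$ (i, j)"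
    using ij slope_carrier[OF k] by simp
  show "cov_mat N s Z ?\<theta> $$ (i, j) = (V + h \<cdot>\<^sub>m slope k) $$ (i, j)"
  proof (cases "k = 0")
    case True
    \<comment> \<open>At \<open>t = 0\<close> the value of \<open>gam\<close> is the constant 1 and
      not \<open>\<theta> $ 0\<close>, so this shift touches only the leading factor.\<close>
    have "gam ?\<theta> t = gam \<theta> t" if "t \<le> s" for t
      using True that theta_simps(3) by (simp add: gam_def)
    moreover have "?\<theta> $ 0 = \<theta> $ 0 + h" using True theta_simps(3) by simp
    ultimately have "cov_mat N s Z ?\<theta> $$ (i, j) = (\<theta> $ 0 + h) * (\<Sum>t\<le>s. gam \<theta> t * ?g t)"
      unfolding cov_mat_entry[OF ij] by (intro arg_cong2[where f = "(*)"] sum.cong refl) auto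
    moreover have "slope k $$ (i, j) = 1 / \<theta> $ 0 * V $$ (i, j)"
      using True ij V_carrier[of \<theta>] by (simp add: slope_def)
    moreover have "\<theta> $ 0 \<noteq> 0" using \<sigma>0 by (simp add: theta_simps)
    ultimately show ?thesis
      unfolding rhs cov_mat_entry[OF ij, of \<theta>] by (simp add: distrib_right)
  next
    case False
    have "gam ?\<theta> t = gam \<theta> t + (if t = k then h else 0)" if "t \<le> s" for t
      using False that k theta_simps(3) by (simp add: gam_def)
    moreover have "?\<theta> $ 0 = \<theta> $ 0" using False k theta_simps(3) by simp
    ultimately have "cov_mat N s Z ?\<theta> $$ (i, j) =
        \<theta> $ 0 * (\<Sum>t\<le>s. (gam \<theta> t + (if t = k then h else 0)) * ?g t)"
      unfolding cov_mat_entry[OF ij] by (intro arg_cong2[where f = "(*)"] sum.cong refl) auto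
    also have "\<dots> = \<theta> $ 0 * (\<Sum>t\<le>s. gam \<theta> t * ?g t + (if t = k then h * ?g k else 0))"
      by (intro arg_cong2[where f = "(*)"] sum.cong refl) (simp add: distrib_right)
    also have "\<dots> = V $$ (i, j) + h * (\<theta> $ 0 * ?g k)"
      using k by (simp add: cov_mat_entry[OF ij] sum.distrib distrib_left mult_ac)
    also have "\<theta> $ 0 * ?g k = slope k $$ (i, j)"
      using False ij k Z_dim[OF k] by (simp add: slope_def Z_gram_entry del: index_mult_mat(1))
    finally show ?thesis by (simp add: rhs)
  qed
qed (use slope_carrier[OF k] V_carrier in auto)

section \<open>Score as quadratic and linear forms in the residual\<close>

text \<open>The log determinant contributes only the trace term. It is the mean of the quadratic
  form, but for covariances it matters only that it does not depend on the data.\<close>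

lemma score_theta:
  assumes X: "X \<in> carrier_mat N p" and \<beta>: "\<beta> \<in> carrier_vec p" and y: "y \<in> carrier_vec N"
    and k: "k \<le> s"
  shows "score c N p s X Z y (\<beta> @\<^sub>v \<theta>) (p + k) =
    (y - X *\<^sub>v \<beta>) \<bullet> (C k *\<^sub>v (y - X *\<^sub>v \<beta>)) - mat_trace (W * slope k) / 2"
proof -
  let ?u = "y - X *\<^sub>v \<beta>"
  let ?\<psi> = "\<lambda>h. (\<beta> @\<^sub>v \<theta>) + h \<cdot>\<^sub>v unit_vec (p + s + 1) (p + k)"
  have u: "?u \<in> carrier_vec N" using X y \<beta> by auto
  have first: "vec_first (?\<psi> h) p = \<beta>" for h
    using \<beta> theta_simps(3) k by (intro eq_vecI) (auto simp: vec_first_def)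
  have last: "vec_last (?\<psi> h) (s + 1) = \<theta> + h \<cdot>\<^sub>v unit_vec (s + 1) k" for h
    using \<beta> theta_simps(3) k by (intro eq_vecI) (auto simp: vec_last_def)
  have eq: "gauss_loglik c N s X Z y (vec_first (?\<psi> h) p) (vec_last (?\<psi> h) (s + 1)) =
      c - 1/2 * (ln (det (V + h \<cdot>\<^sub>m slope k)) + ?u \<bullet> (mat_inv (V + h \<cdot>\<^sub>m slope k) *\<^sub>v ?u))" for h
    unfolding gauss_loglik_def first last cov_mat_shift[OF k] ..
  have V0: "V + 0 \<cdot>\<^sub>m slope k = V" using V_carrier[of \<theta>] slope_carrier[OF k] by (intro eq_matI) auto
  have S: "slope k \<in> carrier_mat N N" by (rule slope_carrier[OF k])
  have "det V \<noteq> 0" using det_V by simp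
  note derivs = DERIV_det_affine[OF V_carrier S this] DERIV_quad_mat_inv_affine[OF V_carrier S this u]
  have "((\<lambda>h. c - 1/2 * (ln (det (V + h \<cdot>\<^sub>m slope k)) + ?u \<bullet> (mat_inv (V + h \<cdot>\<^sub>m slope k) *\<^sub>v ?u)))
      has_field_derivative
      0 - 1/2 * (1 / det (V + 0 \<cdot>\<^sub>m slope k) * (det V * mat_trace (W * slope k)) +
        - (?u \<bullet> ((W * slope k * W) *\<^sub>v ?u)))) (at 0)"
    using det_V
    by (intro DERIV_diff DERIV_const DERIV_cmult DERIV_add derivs DERIV_chain2[OF DERIV_ln_divide])
      (simp add: V0)
  from DERIV_imp_deriv[OF this]
  have "score c N p s X Z y (\<beta> @\<^sub>v \<theta>) (p + k) = 0 - 1/2 * (1 / det (V + 0 \<cdot>\<^sub>m slope k) *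
      (det V * mat_trace (W * slope k)) + - (?u \<bullet> ((W * slope k * W) *\<^sub>v ?u)))"
    unfolding score_def Let_def eq .
  moreover have "?u \<bullet> (C k *\<^sub>v ?u) = 1/2 * (?u \<bullet> ((W * slope k * W) *\<^sub>v ?u))"
  proof -
    have WSW: "W * slope k * W \<in> carrier_mat N N" using W(1) S by (intro mult_carrier_mat)
    then have "(W * slope k * W) *\<^sub>v ?u \<in> carrier_vec N" using u by (rule mult_mat_vec_carrier)
    then show ?thesis
      unfolding C_eq_slope[OF k] smult_mat_mult_vec[OF WSW u] by (rule scalar_prod_smult_distrib[OF u])
  qed
  ultimately show ?thesis
    using det_V by (simp add: V0 add_divide_distrib diff_divide_distrib)
qed

text \<open>Along a coordinate of \<beta> the matrix V is fixed and the log-likelihood is a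
  quadratic polynomial in \<open>h\<close>, so its derivative at 0 is the linear
  coefficient.\<close>

lemma score_beta:
  assumes X: "X \<in> carrier_mat N p" and \<beta>: "\<beta> \<in> carrier_vec p" and y: "y \<in> carrier_vec N"
    and j: "j < p"
  shows "score c N p s X Z y (\<beta> @\<^sub>v \<theta>) j = (W *\<^sub>v col X j) \<bullet> (y - X *\<^sub>v \<beta>)"
proof -
  let ?u = "y - X *\<^sub>v \<beta>" and ?x = "col X j"
  let ?\<psi> = "\<lambda>h. (\<beta> @\<^sub>v \<theta>) + h \<cdot>\<^sub>v unit_vec (p + s + 1) j"
  have u: "?u \<in> carrier_vec N" and x: "?x \<in> carrier_vec N" using X y \<beta> j by auto
  have first: "vec_first (?\<psi> h) p = \<beta> + h \<cdot>\<^sub>v unit_vec p j" for h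
    using \<beta> theta_simps(3) j by (intro eq_vecI) (auto simp: vec_first_def)
  have last: "vec_last (?\<psi> h) (s + 1) = \<theta>" for h
    using \<beta> theta_simps(3) j by (intro eq_vecI) (auto simp: vec_last_def)
  have shift: "y - X *\<^sub>v (\<beta> + h \<cdot>\<^sub>v unit_vec p j) = ?u - h \<cdot>\<^sub>v ?x" for h
  proof -
    have "X *\<^sub>v (\<beta> + h \<cdot>\<^sub>v unit_vec p j) = X *\<^sub>v \<beta> + h \<cdot>\<^sub>v ?x"
      using X \<beta> j by (simp add: mult_add_distrib_mat_vec[of _ N p] mult_mat_vec[of _ N p] mult_mat_unit_vec)
    then show ?thesis
      using X y by (intro eq_vecI) (simp_all del: index_mult_mat_vec)
  qed
  let ?q = "\<lambda>a b. a \<bullet> (W *\<^sub>v b)"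
  \<comment> \<open>Symmetry of the inverse merges the two cross terms; the resulting 2 cancels the
    factor 1/2 of the log-likelihood.\<close>
  have sym: "?q ?u ?x = ?q ?x ?u"
  proof -
    have W_ij: "W $$ (i, j) = W $$ (j, i)" if "i < N" "j < N" for i j
      using W_sym W(1) that by (metis carrier_matD index_transpose_mat(1))
    show ?thesis
      unfolding mat_quad_sum[OF W(1) u x] mat_quad_sum[OF W(1) x u]
      by (subst sum.swap) (intro sum.cong refl, simp add: W_ij mult_ac)
  qed
  have quad: "?q (?u - h \<cdot>\<^sub>v ?x) (?u - h \<cdot>\<^sub>v ?x) = ?q ?u ?u - h * (2 * ?q ?x ?u) + h * h * ?q ?x ?x" for h
  proof -
    have expand: "(a - h * x) * w * (b - h * y) = a * w * b - h * (x * w * b) - h * (a * w * y) + h * h * (x * w * y)"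
      for a x w b y :: real
      by (simp add: algebra_simps)
    have "?q (a - h \<cdot>\<^sub>v ?x) (b - h \<cdot>\<^sub>v ?x) = ?q a b - h * ?q ?x b - h * ?q a ?x + h * h * ?q ?x ?x"
      if "a \<in> carrier_vec N" "b \<in> carrier_vec N" for a b
    proof -
      have dx: "dim_vec ?x = N" using carrier_vecD[OF x] .
      have "?q (a - h \<cdot>\<^sub>v ?x) (b - h \<cdot>\<^sub>v ?x) =
          (\<Sum>i<N. \<Sum>j<N. (a $ i - h * ?x $ i) * W $$ (i, j) * (b $ j - h * ?x $ j))"
      proof -
        have "a - h \<cdot>\<^sub>v ?x \<in> carrier_vec N" "b - h \<cdot>\<^sub>v ?x \<in> carrier_vec N"
          using that x by auto
        from mat_quad_sum[OF W(1) this] show ?thesis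
          using that x dx by (simp del: index_col)
      qed
      also have "\<dots> = (\<Sum>i<N. \<Sum>j<N. a $ i * W $$ (i, j) * b $ j - h * (?x $ i * W $$ (i, j) * b $ j)
          - h * (a $ i * W $$ (i, j) * ?x $ j) + h * h * (?x $ i * W $$ (i, j) * ?x $ j))"
        by (simp only: expand)
      also have "\<dots> = ?q a b - h * ?q ?x b - h * ?q a ?x + h * h * ?q ?x ?x"
        unfolding mat_quad_sum[OF W(1) that] mat_quad_sum[OF W(1) x that(2)]
          mat_quad_sum[OF W(1) that(1) x] mat_quad_sum[OF W(1) x x] sum_distrib_left
        by (simp only: sum.distrib sum_subtractf)
      finally show ?thesis .
    qed
    from this[OF u u] show ?thesis by (simp add: sym)
  qed
  have eq: "gauss_loglik c N s X Z y (vec_first (?\<psi> h) p) (vec_last (?\<psi> h) (s + 1)) =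
      c - 1/2 * (ln (det V) + (?q ?u ?u - h * (2 * ?q ?x ?u) + h * h * ?q ?x ?x))" for h
    unfolding gauss_loglik_def first last shift quad ..
  have "?q ?x ?u = (W *\<^sub>v ?x) \<bullet> ?u"
    using comm_scalar_prod[OF u mult_mat_vec_carrier[OF W(1) x]] sym by simp
  moreover have "score c N p s X Z y (\<beta> @\<^sub>v \<theta>) j = ?q ?x ?u"
    unfolding score_def Let_def eq
    by (intro DERIV_imp_deriv) (auto intro!: derivative_eq_intros)
  ultimately show ?thesis by simp
qed

end

section \<open>Covariances of the score\<close>

text \<open>\<open>H (T i)\<close> is constant on a level set of \<open>T\<close>, and there the
  number of indices times the average of \<open>g\<close> is the sum of \<open>g\<close>.\<close>

lemma sum_level_average:
  fixes g :: "'i \<Rightarrow> real"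
  assumes "finite I"
  shows "(\<Sum>i\<in>{i \<in> I. T i \<noteq> z}. 1 / real (card {i' \<in> I. T i' = T i}) *
      sum g {i' \<in> I. T i' = T i} * H (T i)) = (\<Sum>i\<in>{i \<in> I. T i \<noteq> z}. g i * H (T i))"
proof -
  let ?I = "{i \<in> I. T i \<noteq> z}"
  have fin: "finite ?I" using assms by simp
  \<comment> \<open>Excluding the value \<open>z\<close> removes a whole level set, so every
    remaining one is still complete and the averages keep their denominators.\<close>
  have level: "{i \<in> ?I. T i = y} = {i' \<in> I. T i' = y}" if "y \<in> T ` ?I" for y
    using that by auto
  have "(\<Sum>i\<in>?I. 1 / real (card {i' \<in> I. T i' = T i}) * sum g {i' \<in> I. T i' = T i} * H (T i)) =
      (\<Sum>y\<in>T ` ?I. \<Sum>i\<in>{i \<in> ?I. T i = y}. 1 / real (card {i' \<in> I. T i' = y}) *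
        sum g {i' \<in> I. T i' = y} * H y)"
    by (subst sum.image_gen[OF fin, of _ T]) (intro sum.cong refl, auto)
  also have "\<dots> = (\<Sum>y\<in>T ` ?I. \<Sum>i\<in>{i \<in> ?I. T i = y}. g i * H (T i))"
  proof (rule sum.cong[OF refl])
    fix y assume y: "y \<in> T ` ?I"
    then have "card {i' \<in> I. T i' = y} \<noteq> 0" using assms by auto
    then have "(\<Sum>i\<in>{i' \<in> I. T i' = y}. 1 / real (card {i' \<in> I. T i' = y}) *
        sum g {i' \<in> I. T i' = y} * H y) = sum g {i' \<in> I. T i' = y} * H y"
      by simp
    also have "\<dots> = (\<Sum>i\<in>{i' \<in> I. T i' = y}. g i * H (T i))"
      by (simp add: sum_distrib_right)
    finally show "(\<Sum>i\<in>{i \<in> ?I. T i = y}. 1 / real (card {i' \<in> I. T i' = y}) *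
        sum g {i' \<in> I. T i' = y} * H y) = (\<Sum>i\<in>{i \<in> ?I. T i = y}. g i * H (T i))"
      unfolding level[OF y] .
  qed
  also have "\<dots> = (\<Sum>i\<in>?I. g i * H (T i))"
    by (rule sum.image_gen[OF fin, symmetric])
  finally show ?thesis .
qed

lemma sum_idx3: "(\<Sum>(i1, i2, i3)\<in>idx3 N. g i1 i2 i3) = (\<Sum>i1<N. \<Sum>i2<N. \<Sum>i3<N. g i1 i2 i3)"
  by (simp add: idx3_def sum.cartesian_product)

lemma sum_idx4:
  "(\<Sum>(i1, i2, i3, i4)\<in>idx4 N. g i1 i2 i3 i4) = (\<Sum>i1<N. \<Sum>i2<N. \<Sum>i3<N. \<Sum>i4<N. g i1 i2 i3 i4)"
  by (simp add: idx4_def sum.cartesian_product)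

lemma finite_idx: "finite (idx3 N)" "finite (idx4 N)"
  by (simp_all add: idx3_def idx4_def)

text \<open>Removes the nonrandom parts of the scores. The equations are required on
  \<open>space M\<close> only, since the model equation holds only there.\<close>

lemma (in prob_space) covariance_shift:
  assumes "integrable M F" "integrable M G" "integrable M (\<lambda>\<omega>. F \<omega> * G \<omega>)"
    and S: "\<And>\<omega>. \<omega> \<in> space M \<Longrightarrow> S \<omega> = F \<omega> + a" and T: "\<And>\<omega>. \<omega> \<in> space M \<Longrightarrow> T \<omega> = G \<omega> + (b :: real)"
  shows "(\<integral>\<omega>. (S \<omega> - (\<integral>\<omega>'. S \<omega>' \<partial>M)) * (T \<omega> - (\<integral>\<omega>'. T \<omega>' \<partial>M)) \<partial>M) =
    expectation (\<lambda>\<omega>. F \<omega> * G \<omega>) - expectation F * expectation G"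
proof -
  have ES: "(\<integral>\<omega>'. S \<omega>' \<partial>M) = expectation F + a"
    using assms by (simp add: S prob_space cong: Bochner_Integration.integral_cong)
  have ET: "(\<integral>\<omega>'. T \<omega>' \<partial>M) = expectation G + b"
    using assms by (simp add: T prob_space cong: Bochner_Integration.integral_cong)
  have "(\<integral>\<omega>. (S \<omega> - (\<integral>\<omega>'. S \<omega>' \<partial>M)) * (T \<omega> - (\<integral>\<omega>'. T \<omega>' \<partial>M)) \<partial>M) =
      (\<integral>\<omega>. F \<omega> * G \<omega> - F \<omega> * expectation G - expectation F * G \<omega> + expectation F * expectation G \<partial>M)"
    by (intro Bochner_Integration.integral_cong refl) (simp add: S T ES ET algebra_simps)
  also have "\<dots> = expectation (\<lambda>\<omega>. F \<omega> * G \<omega>) - expectation F * expectation G"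
    using assms(1-3) by (simp add: prob_space)
  finally show ?thesis .
qed

text \<open>The cyclic index pattern is arranged so that, with V for \<open>B\<close> and
  \<open>E\<close>, the trace is the sum belonging to the pairing of the second with the third and
  the first with the fourth index.\<close>

lemma mat_trace_mult4:
  assumes "A \<in> carrier_mat n n" "B \<in> carrier_mat n n" "D \<in> carrier_mat n n" "E \<in> carrier_mat n n"
  shows "mat_trace (A * B * D * E) =
    (\<Sum>(i, j, k, l)\<in>idx4 n. A $$ (i, j) * D $$ (k, l) * (B $$ (j, k) * E $$ (l, i)))"
proof -
  have AB: "A * B \<in> carrier_mat n n" and ABD: "A * B * D \<in> carrier_mat n n"
    and ABDE: "A * B * D * E \<in> carrier_mat n n"
    using assms by (auto intro!: mult_carrier_mat)
  have "mat_trace (A * B * D * E) = (\<Sum>i<n. (A * B * D * E) $$ (i, i))"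
    unfolding mat_trace_def carrier_matD(1)[OF ABDE] ..
  also have "\<dots> = (\<Sum>i<n. \<Sum>l<n. \<Sum>k<n. \<Sum>j<n. A $$ (i, j) * D $$ (k, l) * (B $$ (j, k) * E $$ (l, i)))"
  proof (rule sum.cong[OF refl])
    fix i assume "i \<in> {..<n}"
    then show "(A * B * D * E) $$ (i, i) =
        (\<Sum>l<n. \<Sum>k<n. \<Sum>j<n. A $$ (i, j) * D $$ (k, l) * (B $$ (j, k) * E $$ (l, i)))"
      by (simp add: mat_mult_sum[OF ABD assms(4)] mat_mult_sum[OF AB assms(3)]
          mat_mult_sum[OF assms(1,2)] del: index_mult_mat)
        (simp only: sum_distrib_right, simp only: mult_ac)
  qed
  also have "\<dots> = (\<Sum>i<n. \<Sum>j<n. \<Sum>k<n. \<Sum>l<n. A $$ (i, j) * D $$ (k, l) * (B $$ (j, k) * E $$ (l, i)))"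
    by (rule sum.cong[OF refl], subst sum_rotate3, rule sum.cong[OF refl], rule sum.swap)
  finally show ?thesis by (simp add: sum_idx4)
qed

section \<open>Random effects and moments of the residual\<close>

text \<open>Moments depend on \<open>t\<close> alone, which is the form in which identical
  distribution enters. The fourth moment is written so that \<open>\<kappa> t\<close> is the
  cumulant \<open>\<eta>\<close> of the flattened family.\<close>

locale mixed_model = mixed_design N s m Z \<sigma> \<theta> + prob_space M
  for N s m Z \<sigma> \<theta> and M :: "'w measure" +
  fixes \<alpha> :: "nat \<Rightarrow> nat \<Rightarrow> 'w \<Rightarrow> real" and \<mu>3 \<kappa> :: "nat \<Rightarrow> real" and u :: "'w \<Rightarrow> real vec"
  assumes vectors_indep: "indep_vars (\<lambda>t. \<Pi>\<^sub>M l\<in>{..<m t}. (borel :: real measure))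
        (\<lambda>t \<omega>. \<lambda>l\<in>{..<m t}. \<alpha> t l \<omega>) {..s}"
    and components_indep: "\<And>t. t \<le> s \<Longrightarrow> indep_vars (\<lambda>_. borel) (\<alpha> t) {..<m t}"
    and fourth_moments: "\<And>t l. t \<le> s \<Longrightarrow> l < m t \<Longrightarrow> integrable M (\<lambda>\<omega>. \<alpha> t l \<omega> ^ 4)"
    and moment1: "\<And>t l. t \<le> s \<Longrightarrow> l < m t \<Longrightarrow> expectation (\<alpha> t l) = 0"
    and moment2: "\<And>t l. t \<le> s \<Longrightarrow> l < m t \<Longrightarrow> expectation (\<lambda>\<omega>. \<alpha> t l \<omega> ^ 2) = (\<sigma> t)\<^sup>2"
    and moment3: "\<And>t l. t \<le> s \<Longrightarrow> l < m t \<Longrightarrow> expectation (\<lambda>\<omega>. \<alpha> t l \<omega> ^ 3) = \<mu>3 t"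
    and moment4: "\<And>t l. t \<le> s \<Longrightarrow> l < m t \<Longrightarrow>
      expectation (\<lambda>\<omega>. \<alpha> t l \<omega> ^ 4) = \<kappa> t + 3 * ((\<sigma> t)\<^sup>2)\<^sup>2"
    and u_dim: "\<And>\<omega>. \<omega> \<in> space M \<Longrightarrow> u \<omega> \<in> carrier_vec N"
    and u_entry: "\<And>\<omega> i. \<omega> \<in> space M \<Longrightarrow> i < N \<Longrightarrow>
      u \<omega> $ i = (\<Sum>t\<le>s. \<Sum>l<m t. Z t $$ (i, l) * \<alpha> t l \<omega>)"
begin

abbreviation J where "J \<equiv> Sigma {..s} (\<lambda>t. {..<m t})"

sublocale fam: centered_indep_family M J "\<lambda>(t, l). \<alpha> t l" "\<lambda>(t, l). (\<sigma> t)\<^sup>2" "\<lambda>(t, l). \<mu>3 t" "\<lambda>(t, l). \<kappa> t"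
proof
  show "indep_vars (\<lambda>_. borel) (\<lambda>(t, l). \<alpha> t l) J"
    using indep_vars_Sigma[OF vectors_indep] components_indep by (simp add: case_prod_unfold)
qed (use fourth_moments moment1 moment2 moment3 moment4 in auto)

definition z :: "nat \<Rightarrow> nat \<times> nat \<Rightarrow> real" where
  "z i = (\<lambda>(t, l). Z t $$ (i, l))"

abbreviation U where "U i \<equiv> fam.lin (z i)"

lemma dim_col_Z: "t \<le> s \<Longrightarrow> dim_col (Z t) = m t"
  using carrier_matD(2)[OF Z_dim] .

lemma sum_J: "(\<Sum>a\<in>J. case a of (t, l) \<Rightarrow> g t l) = (\<Sum>t\<le>s. \<Sum>l<m t. g t l)"
  by (simp add: sum.Sigma)

lemma u_U: "\<omega> \<in> space M \<Longrightarrow> i < N \<Longrightarrow> u \<omega> $ i = U i \<omega>"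
  unfolding fam.lin_def z_def by (simp add: u_entry case_prod_unfold sum.Sigma)

text \<open>Level sets are formed from coefficient vectors, expectations from their values at the
  actual moments. This map passes from the former to the latter.\<close>

definition eval_coeffs :: "(nat \<Rightarrow> real) \<Rightarrow> real vec \<Rightarrow> real" where
  "eval_coeffs \<nu> g = (\<Sum>t\<le>s. \<nu> t * g $ t)"

lemma eval_coeffs_zero: "eval_coeffs \<nu> (0\<^sub>v (Suc s)) = 0"
  by (simp add: eval_coeffs_def)

lemma eval_coeffs_tfun: "(\<Sum>a\<in>J. (case a of (t, l) \<Rightarrow> \<nu> t) * (z i1 a * z i2 a * z i3 a)) = eval_coeffs \<nu> (tfun s Z (i1, i2, i3))"
proof -
  have "eval_coeffs \<nu> (tfun s Z (i1, i2, i3)) =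
      (\<Sum>t\<le>s. \<Sum>l<m t. \<nu> t * (Z t $$ (i1, l) * Z t $$ (i2, l) * Z t $$ (i3, l)))"
    unfolding eval_coeffs_def tfun_def by (intro sum.cong refl) (auto simp: dim_col_Z sum_distrib_left)
  then show ?thesis by (simp add: z_def case_prod_unfold sum.Sigma)
qed

lemma eval_coeffs_ffun:
  "(\<Sum>a\<in>J. (case a of (t, l) \<Rightarrow> \<nu> t) * (z i1 a * z i2 a * z i3 a * z i4 a)) = eval_coeffs \<nu> (ffun s Z (i1, i2, i3, i4))"
proof -
  have "eval_coeffs \<nu> (ffun s Z (i1, i2, i3, i4)) =
      (\<Sum>t\<le>s. \<Sum>l<m t. \<nu> t * (Z t $$ (i1, l) * Z t $$ (i2, l) * Z t $$ (i3, l) * Z t $$ (i4, l)))"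
    unfolding eval_coeffs_def ffun_def by (intro sum.cong refl) (auto simp: dim_col_Z sum_distrib_left)
  then show ?thesis by (simp add: z_def case_prod_unfold sum.Sigma)
qed

lemma sum_var_z:
  assumes "i < N" "j < N"
  shows "(\<Sum>a\<in>J. (case a of (t, l) \<Rightarrow> (\<sigma> t)\<^sup>2) * (z i a * z j a)) = V $$ (i, j)"
  using assms by (simp add: V_entry z_def case_prod_unfold sum.Sigma sum_distrib_left)

lemma expectation_U:
  shows "integrable M (U i)" "expectation (U i) = 0"
    and "integrable M (\<lambda>\<omega>. U i \<omega> * U j \<omega>)"
    and "i < N \<Longrightarrow> j < N \<Longrightarrow> expectation (\<lambda>\<omega>. U i \<omega> * U j \<omega>) = V $$ (i, j)"
    and "integrable M (\<lambda>\<omega>. U i \<omega> * U j \<omega> * U k \<omega>)"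
    and "expectation (\<lambda>\<omega>. U i \<omega> * U j \<omega> * U k \<omega>) = eval_coeffs \<mu>3 (tfun s Z (i, j, k))"
    and "integrable M (\<lambda>\<omega>. U i \<omega> * U j \<omega> * U k \<omega> * U l \<omega>)"
    and "i < N \<Longrightarrow> j < N \<Longrightarrow> k < N \<Longrightarrow> l < N \<Longrightarrow>
      expectation (\<lambda>\<omega>. U i \<omega> * U j \<omega> * U k \<omega> * U l \<omega>) = eval_coeffs \<kappa> (ffun s Z (i, j, k, l)) +
        V $$ (i, j) * V $$ (k, l) + V $$ (i, k) * V $$ (j, l) + V $$ (i, l) * V $$ (j, k)"
  by (simp_all only: fam.expectation_lin fam.expectation_lin2 fam.expectation_lin3 fam.expectation_lin4 sum_var_z eval_coeffs_tfun eval_coeffs_ffun)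

text \<open>Coefficients and index set are arbitrary, so the same formula serves the original
  coefficients on all tuples and the averaged ones on the tuples with t \<noteq> 0.\<close>

lemma expectation_sum3:
  assumes "S \<subseteq> idx3 N"
  shows "integrable M (\<lambda>\<omega>. \<Sum>(i1, i2, i3)\<in>S. d (i1, i2, i3) * (U i1 \<omega> * U i2 \<omega> * U i3 \<omega>))"
    and "expectation (\<lambda>\<omega>. \<Sum>(i1, i2, i3)\<in>S. d (i1, i2, i3) * (U i1 \<omega> * U i2 \<omega> * U i3 \<omega>)) =
      (\<Sum>i\<in>S. d i * eval_coeffs \<mu>3 (tfun s Z i))"
proof -
  let ?f = "\<lambda>\<omega> (i1, i2, i3). d (i1, i2, i3) * (U i1 \<omega> * U i2 \<omega> * U i3 \<omega>)"
  have 1: "integrable M (\<lambda>\<omega>. ?f \<omega> i) \<and> expectation (\<lambda>\<omega>. ?f \<omega> i) = d i * eval_coeffs \<mu>3 (tfun s Z i)" for i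
    by (cases i) (simp add: expectation_U)
  then show "integrable M (\<lambda>\<omega>. \<Sum>(i1, i2, i3)\<in>S. d (i1, i2, i3) * (U i1 \<omega> * U i2 \<omega> * U i3 \<omega>))"
    by (intro Bochner_Integration.integrable_sum) blast
  show "expectation (\<lambda>\<omega>. \<Sum>(i1, i2, i3)\<in>S. d (i1, i2, i3) * (U i1 \<omega> * U i2 \<omega> * U i3 \<omega>)) =
      (\<Sum>i\<in>S. d i * eval_coeffs \<mu>3 (tfun s Z i))"
    using 1 by (subst Bochner_Integration.integral_sum) auto
qed

lemma expectation_sum4:
  assumes "S \<subseteq> idx4 N"
  shows "integrable M (\<lambda>\<omega>. \<Sum>(i1, i2, i3, i4)\<in>S. d (i1, i2, i3, i4) *
        (U i1 \<omega> * U i2 \<omega> * U i3 \<omega> * U i4 \<omega>))"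
    and "expectation (\<lambda>\<omega>. \<Sum>(i1, i2, i3, i4)\<in>S. d (i1, i2, i3, i4) *
        (U i1 \<omega> * U i2 \<omega> * U i3 \<omega> * U i4 \<omega>)) =
      (\<Sum>i\<in>S. d i * eval_coeffs \<kappa> (ffun s Z i)) +
      (\<Sum>(i1, i2, i3, i4)\<in>S. d (i1, i2, i3, i4) * (V $$ (i1, i2) * V $$ (i3, i4))) +
      (\<Sum>(i1, i2, i3, i4)\<in>S. d (i1, i2, i3, i4) * (V $$ (i1, i3) * V $$ (i2, i4))) +
      (\<Sum>(i1, i2, i3, i4)\<in>S. d (i1, i2, i3, i4) * (V $$ (i1, i4) * V $$ (i2, i3)))"
proof -
  let ?f = "\<lambda>\<omega> (i1, i2, i3, i4). d (i1, i2, i3, i4) * (U i1 \<omega> * U i2 \<omega> * U i3 \<omega> * U i4 \<omega>)"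
  have 1: "integrable M (\<lambda>\<omega>. ?f \<omega> i)" for i
    by (cases i) (simp add: expectation_U)
  have 2: "expectation (\<lambda>\<omega>. ?f \<omega> i) = d i * eval_coeffs \<kappa> (ffun s Z i) +
      (case i of (i1, i2, i3, i4) \<Rightarrow> d (i1, i2, i3, i4) * (V $$ (i1, i2) * V $$ (i3, i4))) +
      (case i of (i1, i2, i3, i4) \<Rightarrow> d (i1, i2, i3, i4) * (V $$ (i1, i3) * V $$ (i2, i4))) +
      (case i of (i1, i2, i3, i4) \<Rightarrow> d (i1, i2, i3, i4) * (V $$ (i1, i4) * V $$ (i2, i3)))"
    if "i \<in> S" for i
    using that assms by (cases i) (auto simp: idx4_def expectation_U distrib_left)
  show "integrable M (\<lambda>\<omega>. \<Sum>(i1, i2, i3, i4)\<in>S. d (i1, i2, i3, i4) *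
      (U i1 \<omega> * U i2 \<omega> * U i3 \<omega> * U i4 \<omega>))"
    using 1 by (intro Bochner_Integration.integrable_sum)
  have "expectation (\<lambda>\<omega>. \<Sum>i\<in>S. ?f \<omega> i) = (\<Sum>i\<in>S. expectation (\<lambda>\<omega>. ?f \<omega> i))"
    using 1 by (intro Bochner_Integration.integral_sum)
  also have "\<dots> = (\<Sum>i\<in>S. d i * eval_coeffs \<kappa> (ffun s Z i)) +
      (\<Sum>(i1, i2, i3, i4)\<in>S. d (i1, i2, i3, i4) * (V $$ (i1, i2) * V $$ (i3, i4))) +
      (\<Sum>(i1, i2, i3, i4)\<in>S. d (i1, i2, i3, i4) * (V $$ (i1, i3) * V $$ (i2, i4))) +
      (\<Sum>(i1, i2, i3, i4)\<in>S. d (i1, i2, i3, i4) * (V $$ (i1, i4) * V $$ (i2, i3)))"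
    by (simp only: 2 sum.distrib cong: sum.cong)
  finally show "expectation (\<lambda>\<omega>. \<Sum>(i1, i2, i3, i4)\<in>S. d (i1, i2, i3, i4) *
        (U i1 \<omega> * U i2 \<omega> * U i3 \<omega> * U i4 \<omega>)) =
      (\<Sum>i\<in>S. d i * eval_coeffs \<kappa> (ffun s Z i)) +
      (\<Sum>(i1, i2, i3, i4)\<in>S. d (i1, i2, i3, i4) * (V $$ (i1, i2) * V $$ (i3, i4))) +
      (\<Sum>(i1, i2, i3, i4)\<in>S. d (i1, i2, i3, i4) * (V $$ (i1, i3) * V $$ (i2, i4))) +
      (\<Sum>(i1, i2, i3, i4)\<in>S. d (i1, i2, i3, i4) * (V $$ (i1, i4) * V $$ (i2, i3)))" .
qed

text \<open>Linear and quadratic forms are expressed through \<open>U\<close>, which is explicit in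
  the independent variables and agrees with \<open>u\<close> on \<open>space M\<close>.\<close>

definition lform :: "real vec \<Rightarrow> 'w \<Rightarrow> real" where
  "lform q \<omega> = (\<Sum>i<N. q $ i * U i \<omega>)"

definition qform :: "real mat \<Rightarrow> 'w \<Rightarrow> real" where
  "qform A \<omega> = (\<Sum>i<N. \<Sum>j<N. A $$ (i, j) * (U i \<omega> * U j \<omega>))"

lemma lform_u:
  assumes "\<omega> \<in> space M" "q \<in> carrier_vec N"
  shows "q \<bullet> u \<omega> = lform q \<omega>"
  using assms u_dim[OF assms(1)] by (simp add: scalar_prod_def lform_def u_U atLeast0LessThan)

lemma qform_u:
  assumes "\<omega> \<in> space M" "A \<in> carrier_mat N N"
  shows "u \<omega> \<bullet> (A *\<^sub>v u \<omega>) = qform A \<omega>"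
  using assms u_dim[OF assms(1)] by (simp add: mat_quad_sum qform_def u_U mult_ac)

lemma expectation_lform: "integrable M (lform q)" "expectation (lform q) = 0"
  by (simp_all add: lform_def[abs_def] expectation_U)

lemma expectation_qform:
  "integrable M (qform A)" "expectation (qform A) = (\<Sum>i<N. \<Sum>j<N. A $$ (i, j) * V $$ (i, j))"
  by (simp_all add: qform_def[abs_def] expectation_U)

lemma expectation_lform_lform:
  "integrable M (\<lambda>\<omega>. lform q \<omega> * lform r \<omega>)"
  "expectation (\<lambda>\<omega>. lform q \<omega> * lform r \<omega>) = (\<Sum>i<N. \<Sum>j<N. q $ i * V $$ (i, j) * r $ j)"
proof -
  have eq: "lform q \<omega> * lform r \<omega> = (\<Sum>i<N. \<Sum>j<N. q $ i * r $ j * (U i \<omega> * U j \<omega>))" for \<omega>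
    by (simp add: lform_def sum_product mult_ac)
  show "integrable M (\<lambda>\<omega>. lform q \<omega> * lform r \<omega>)"
    "expectation (\<lambda>\<omega>. lform q \<omega> * lform r \<omega>) = (\<Sum>i<N. \<Sum>j<N. q $ i * V $$ (i, j) * r $ j)"
    unfolding eq by (simp_all add: expectation_U mult_ac)
qed

lemma expectation_lform_qform:
  "integrable M (\<lambda>\<omega>. lform q \<omega> * qform A \<omega>)"
  "expectation (\<lambda>\<omega>. lform q \<omega> * qform A \<omega>) =
    (\<Sum>i\<in>idx3 N. (case i of (i1, i2, i3) \<Rightarrow> q $ i1 * A $$ (i2, i3)) * eval_coeffs \<mu>3 (tfun s Z i))"
proof -
  have eq: "lform q \<omega> * qform A \<omega> = (\<Sum>(i1, i2, i3)\<in>idx3 N.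
      (case (i1, i2, i3) of (i1, i2, i3) \<Rightarrow> q $ i1 * A $$ (i2, i3)) * (U i1 \<omega> * U i2 \<omega> * U i3 \<omega>))" for \<omega>
    unfolding lform_def qform_def sum_idx3 prod.case
    by (simp only: sum_distrib_right, simp only: sum_distrib_left) (simp only: mult_ac)
  show "integrable M (\<lambda>\<omega>. lform q \<omega> * qform A \<omega>)"
    "expectation (\<lambda>\<omega>. lform q \<omega> * qform A \<omega>) =
    (\<Sum>i\<in>idx3 N. (case i of (i1, i2, i3) \<Rightarrow> q $ i1 * A $$ (i2, i3)) * eval_coeffs \<mu>3 (tfun s Z i))"
    unfolding eq by (rule expectation_sum3[OF order_refl])+
qed

text \<open>The pairing inside each of the two forms is the product of their expectations and
  cancels; the two pairings across the forms remain.\<close>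

lemma covariance_qform:
  "integrable M (\<lambda>\<omega>. qform A \<omega> * qform B \<omega>)"
  "expectation (\<lambda>\<omega>. qform A \<omega> * qform B \<omega>) - expectation (qform A) * expectation (qform B) =
    (\<Sum>i\<in>idx4 N. (case i of (i1, i2, i3, i4) \<Rightarrow> A $$ (i1, i2) * B $$ (i3, i4)) * eval_coeffs \<kappa> (ffun s Z i)) +
    (\<Sum>(i1, i2, i3, i4)\<in>idx4 N. A $$ (i1, i2) * B $$ (i3, i4) * (V $$ (i1, i3) * V $$ (i2, i4))) +
    (\<Sum>(i1, i2, i3, i4)\<in>idx4 N. A $$ (i1, i2) * B $$ (i3, i4) * (V $$ (i1, i4) * V $$ (i2, i3)))"
proof -
  let ?d = "\<lambda>i. case i of (i1, i2, i3, i4) \<Rightarrow> A $$ (i1, i2) * B $$ (i3, i4)"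
  have eq: "qform A \<omega> * qform B \<omega> = (\<Sum>(i1, i2, i3, i4)\<in>idx4 N.
      ?d (i1, i2, i3, i4) * (U i1 \<omega> * U i2 \<omega> * U i3 \<omega> * U i4 \<omega>))" for \<omega>
    unfolding qform_def sum_idx4 prod.case
    by (simp only: sum_distrib_right, simp only: sum_distrib_left) (simp only: mult_ac)
  show "integrable M (\<lambda>\<omega>. qform A \<omega> * qform B \<omega>)"
    unfolding eq by (rule expectation_sum4[OF order_refl])
  have "expectation (qform A) * expectation (qform B) =
      (\<Sum>(i1, i2, i3, i4)\<in>idx4 N. ?d (i1, i2, i3, i4) * (V $$ (i1, i2) * V $$ (i3, i4)))"
    unfolding expectation_qform sum_idx4 prod.case
    by (simp only: sum_distrib_right, simp only: sum_distrib_left) (simp only: mult_ac)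
  then show "expectation (\<lambda>\<omega>. qform A \<omega> * qform B \<omega>) - expectation (qform A) * expectation (qform B) =
    (\<Sum>i\<in>idx4 N. (case i of (i1, i2, i3, i4) \<Rightarrow> A $$ (i1, i2) * B $$ (i3, i4)) * eval_coeffs \<kappa> (ffun s Z i)) +
    (\<Sum>(i1, i2, i3, i4)\<in>idx4 N. A $$ (i1, i2) * B $$ (i3, i4) * (V $$ (i1, i3) * V $$ (i2, i4))) +
    (\<Sum>(i1, i2, i3, i4)\<in>idx4 N. A $$ (i1, i2) * B $$ (i3, i4) * (V $$ (i1, i4) * V $$ (i2, i3)))"
    using expectation_sum4(2)[OF order_refl, of ?d, folded eq] unfolding prod.case by linarith
qed

lemma V_commute: "i < N \<Longrightarrow> j < N \<Longrightarrow> V $$ (i, j) = V $$ (j, i)"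
  by (simp add: V_entry mult.commute)

text \<open>One cross pairing is the trace up to symmetry of V; the other becomes the same sum after
  exchanging the indices of the symmetric matrix \<open>C k\<close>. Together they produce the
  factor 2 in front of the trace.\<close>

lemma sum_quad_V_eq_trace:
  assumes "j \<le> s" "k \<le> s"
  shows "(\<Sum>(i1, i2, i3, i4)\<in>idx4 N. C j $$ (i1, i2) * C k $$ (i3, i4) * (V $$ (i1, i4) * V $$ (i2, i3))) =
      mat_trace (C j * V * C k * V)" (is ?A)
    and "(\<Sum>(i1, i2, i3, i4)\<in>idx4 N. C j $$ (i1, i2) * C k $$ (i3, i4) * (V $$ (i1, i3) * V $$ (i2, i4))) =
      mat_trace (C j * V * C k * V)" (is ?B)
proof -
  show ?A
    unfolding mat_trace_mult4[OF C_carrier[OF assms(1)] V_carrier C_carrier[OF assms(2)] V_carrier]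
    by (rule sum.cong[OF refl]) (auto simp: idx4_def V_commute)
  have "(\<Sum>(i1, i2, i3, i4)\<in>idx4 N. C j $$ (i1, i2) * C k $$ (i3, i4) * (V $$ (i1, i3) * V $$ (i2, i4))) =
      (\<Sum>(i1, i2, i3, i4)\<in>idx4 N. C j $$ (i1, i2) * C k $$ (i3, i4) * (V $$ (i1, i4) * V $$ (i2, i3)))"
    by (rule sum.reindex_bij_witness[of _ "\<lambda>(i1, i2, i3, i4). (i1, i2, i4, i3)" "\<lambda>(i1, i2, i3, i4). (i1, i2, i4, i3)"])
      (auto simp: idx4_def C_sym[OF assms(2)])
  with \<open>?A\<close> show ?B by simp
qed

text \<open>The function t is a sum over columns of products of three entries, so for a fixed column
  the sum over index triples factors into a scalar product and a quadratic form.\<close>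

lemma sum_tfun_eq_forms:
  assumes q: "q \<in> carrier_vec N" and A: "A \<in> carrier_mat N N"
  shows "(\<Sum>i\<in>idx3 N. (case i of (i1, i2, i3) \<Rightarrow> q $ i1 * A $$ (i2, i3)) * eval_coeffs \<nu> (tfun s Z i)) =
    (\<Sum>t\<le>s. \<nu> t * (\<Sum>l<m t. (q \<bullet> col (Z t) l) * (col (Z t) l \<bullet> (A *\<^sub>v col (Z t) l))))"
proof -
  have "(\<Sum>i\<in>idx3 N. (case i of (i1, i2, i3) \<Rightarrow> q $ i1 * A $$ (i2, i3)) * eval_coeffs \<nu> (tfun s Z i)) =
      (\<Sum>i\<in>idx3 N. \<Sum>a\<in>J. (case a of (t, l) \<Rightarrow> \<nu> t) *
        (case i of (i1, i2, i3) \<Rightarrow> q $ i1 * z i1 a * (z i2 a * A $$ (i2, i3) * z i3 a)))"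
    by (rule sum.cong[OF refl]) (auto simp: sum_distrib_left mult_ac simp flip: eval_coeffs_tfun)
  also have "\<dots> = (\<Sum>a\<in>J. (case a of (t, l) \<Rightarrow> \<nu> t) *
      (\<Sum>(i1, i2, i3)\<in>idx3 N. q $ i1 * z i1 a * (z i2 a * A $$ (i2, i3) * z i3 a)))"
    unfolding sum_distrib_left by (rule sum.swap)
  also have "\<dots> = (\<Sum>a\<in>J. case a of (t, l) \<Rightarrow>
      \<nu> t * ((q \<bullet> col (Z t) l) * (col (Z t) l \<bullet> (A *\<^sub>v col (Z t) l))))"
  proof (rule sum.cong[OF refl], clarify)
    fix t l assume tl: "t \<le> s" "l < m t"
    then have col: "col (Z t) l \<in> carrier_vec N" using Z_dim by auto
    have entry: "col (Z t) l $ i = z i (t, l)" if "i < N" for i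
      using tl that Z_dim[of t] by (simp add: z_def)
    have "q \<bullet> col (Z t) l = (\<Sum>i<N. q $ i * z i (t, l))"
      unfolding scalar_prod_def carrier_vecD[OF col] atLeast0LessThan by (simp add: entry del: index_col)
    moreover have "col (Z t) l \<bullet> (A *\<^sub>v col (Z t) l) =
        (\<Sum>i2<N. \<Sum>i3<N. z i2 (t, l) * A $$ (i2, i3) * z i3 (t, l))"
      unfolding mat_quad_sum[OF A col col] by (simp add: entry del: index_col)
    ultimately have "(\<Sum>(i1, i2, i3)\<in>idx3 N. q $ i1 * z i1 (t, l) * (z i2 (t, l) * A $$ (i2, i3) * z i3 (t, l))) =
        (q \<bullet> col (Z t) l) * (col (Z t) l \<bullet> (A *\<^sub>v col (Z t) l))"
      by (simp only: sum_idx3 sum_distrib_right, simp only: sum_distrib_left)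
    then show "\<nu> t * (\<Sum>(i1, i2, i3)\<in>idx3 N. q $ i1 * z i1 (t, l) * (z i2 (t, l) * A $$ (i2, i3) * z i3 (t, l))) =
        \<nu> t * ((q \<bullet> col (Z t) l) * (col (Z t) l \<bullet> (A *\<^sub>v col (Z t) l)))"
      by simp
  qed
  finally show ?thesis unfolding sum_J sum_distrib_left .
qed

lemma sum_ffun_eq_forms:
  assumes A: "A \<in> carrier_mat N N" and B: "B \<in> carrier_mat N N"
  shows "(\<Sum>i\<in>idx4 N. (case i of (i1, i2, i3, i4) \<Rightarrow> A $$ (i1, i2) * B $$ (i3, i4)) * eval_coeffs \<nu> (ffun s Z i)) =
    (\<Sum>t\<le>s. \<nu> t * (\<Sum>l<m t. (col (Z t) l \<bullet> (A *\<^sub>v col (Z t) l)) * (col (Z t) l \<bullet> (B *\<^sub>v col (Z t) l))))"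
proof -
  let ?p = "\<lambda>a (i1, i2, i3, i4). (z i1 a * A $$ (i1, i2) * z i2 a) * (z i3 a * B $$ (i3, i4) * z i4 a)"
  have "(\<Sum>i\<in>idx4 N. (case i of (i1, i2, i3, i4) \<Rightarrow> A $$ (i1, i2) * B $$ (i3, i4)) * eval_coeffs \<nu> (ffun s Z i)) =
      (\<Sum>i\<in>idx4 N. \<Sum>a\<in>J. (case a of (t, l) \<Rightarrow> \<nu> t) * ?p a i)"
    by (rule sum.cong[OF refl]) (auto simp: sum_distrib_left mult_ac simp flip: eval_coeffs_ffun)
  also have "\<dots> = (\<Sum>a\<in>J. (case a of (t, l) \<Rightarrow> \<nu> t) * (\<Sum>i\<in>idx4 N. ?p a i))"
    unfolding sum_distrib_left by (rule sum.swap)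
  also have "\<dots> = (\<Sum>a\<in>J. case a of (t, l) \<Rightarrow>
      \<nu> t * ((col (Z t) l \<bullet> (A *\<^sub>v col (Z t) l)) * (col (Z t) l \<bullet> (B *\<^sub>v col (Z t) l))))"
  proof (rule sum.cong[OF refl], clarify)
    fix t l assume tl: "t \<le> s" "l < m t"
    then have col: "col (Z t) l \<in> carrier_vec N" using Z_dim by auto
    have entry: "col (Z t) l $ i = z i (t, l)" if "i < N" for i
      using tl that Z_dim[of t] by (simp add: z_def)
    have form: "col (Z t) l \<bullet> (D *\<^sub>v col (Z t) l) =
        (\<Sum>i<N. \<Sum>j<N. z i (t, l) * D $$ (i, j) * z j (t, l))" if "D \<in> carrier_mat N N" for D
      unfolding mat_quad_sum[OF that col col] by (simp add: entry del: index_col)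
    have "(\<Sum>i\<in>idx4 N. ?p (t, l) i) =
        (col (Z t) l \<bullet> (A *\<^sub>v col (Z t) l)) * (col (Z t) l \<bullet> (B *\<^sub>v col (Z t) l))"
      unfolding form[OF A] form[OF B]
      by (simp only: sum_idx4 sum_distrib_right, simp only: sum_distrib_left)
    then show "\<nu> t * (\<Sum>i\<in>idx4 N. ?p (t, l) i) =
        \<nu> t * ((col (Z t) l \<bullet> (A *\<^sub>v col (Z t) l)) * (col (Z t) l \<bullet> (B *\<^sub>v col (Z t) l)))"
      by simp
  qed
  finally show ?thesis unfolding sum_J sum_distrib_left .
qed

section \<open>Averaged coefficients on level sets\<close>

text \<open>The summand sees a tuple only through its coefficient vector, so the average may be
  undone; tuples with t = 0 evaluate to 0 and may be added back.\<close>

lemma sum_c1: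
  "(\<Sum>i\<in>{i \<in> idx3 N. tfun s Z i \<noteq> 0\<^sub>v (s + 1)}. c1 N s X Z \<theta> j k i * eval_coeffs \<nu> (tfun s Z i)) =
    (\<Sum>i\<in>idx3 N. (case i of (i1, i2, i3) \<Rightarrow> (W *\<^sub>v col X j) $ i1 * C k $$ (i2, i3)) * eval_coeffs \<nu> (tfun s Z i))"
  unfolding c1_def c1_level_def
  by (subst sum_level_average[OF finite_idx(1)], rule sum.mono_neutral_left)
    (auto simp: finite_idx eval_coeffs_zero)

lemma sum_c2:
  "(\<Sum>i\<in>{i \<in> idx4 N. ffun s Z i \<noteq> 0\<^sub>v (s + 1)}. c2 N s Z \<theta> j k i * eval_coeffs \<nu> (ffun s Z i)) =
    (\<Sum>i\<in>idx4 N. (case i of (i1, i2, i3, i4) \<Rightarrow> C j $$ (i1, i2) * C k $$ (i3, i4)) * eval_coeffs \<nu> (ffun s Z i))"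
  unfolding c2_def c2_level_def
  by (subst sum_level_average[OF finite_idx(2)], rule sum.mono_neutral_left)
    (auto simp: finite_idx eval_coeffs_zero)

lemma expectation_c1:
  "(\<integral>\<omega>. (\<Sum>(i1, i2, i3)\<in>{i \<in> idx3 N. tfun s Z i \<noteq> 0\<^sub>v (s + 1)}.
      c1 N s X Z \<theta> j k (i1, i2, i3) * (u \<omega> $ i1 * u \<omega> $ i2 * u \<omega> $ i3)) \<partial>M) =
    (\<Sum>i\<in>idx3 N. (case i of (i1, i2, i3) \<Rightarrow> (W *\<^sub>v col X j) $ i1 * C k $$ (i2, i3)) * eval_coeffs \<mu>3 (tfun s Z i))"
proof -
  let ?S = "{i \<in> idx3 N. tfun s Z i \<noteq> 0\<^sub>v (s + 1)}"
  have "(\<integral>\<omega>. (\<Sum>(i1, i2, i3)\<in>?S. c1 N s X Z \<theta> j k (i1, i2, i3) * (u \<omega> $ i1 * u \<omega> $ i2 * u \<omega> $ i3)) \<partial>M) =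
      (\<integral>\<omega>. (\<Sum>(i1, i2, i3)\<in>?S. c1 N s X Z \<theta> j k (i1, i2, i3) * (U i1 \<omega> * U i2 \<omega> * U i3 \<omega>)) \<partial>M)"
    by (intro Bochner_Integration.integral_cong refl sum.cong) (auto simp: idx3_def u_U)
  also have "\<dots> = (\<Sum>i\<in>?S. c1 N s X Z \<theta> j k i * eval_coeffs \<mu>3 (tfun s Z i))"
    by (rule expectation_sum3) auto
  finally show ?thesis by (simp only: sum_c1)
qed

text \<open>These two transpositions suffice to carry each of the other pairings of four positions
  to the pairing of first with third and second with fourth.\<close>

lemma ffun_swap:
  "ffun s Z (i1, i3, i2, i4) = ffun s Z (i1, i2, i3, i4)"
  "ffun s Z (i1, i2, i4, i3) = ffun s Z (i1, i2, i3, i4)"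
  by (auto simp: ffun_def mult_ac)

text \<open>Each pairing contributes the same multiple of \<lambda> squared, so subtracting it three
  times leaves the part linear in \<kappa>, where averaging has no effect.\<close>

lemma expectation_c2:
  "(\<integral>\<omega>. (\<Sum>(i1, i2, i3, i4)\<in>{i \<in> idx4 N. ffun s Z i \<noteq> 0\<^sub>v (s + 1)}.
      c2 N s Z \<theta> j k (i1, i2, i3, i4) * (u \<omega> $ i1 * u \<omega> $ i2 * u \<omega> $ i3 * u \<omega> $ i4)) \<partial>M) -
    3 * (\<theta> $ 0)\<^sup>2 * (\<Sum>(i1, i2, i3, i4)\<in>{i \<in> idx4 N. ffun s Z i \<noteq> 0\<^sub>v (s + 1)}.
      c2 N s Z \<theta> j k (i1, i2, i3, i4) * (Gam s Z \<theta> i1 i3 * Gam s Z \<theta> i2 i4)) =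
    (\<Sum>i\<in>idx4 N. (case i of (i1, i2, i3, i4) \<Rightarrow> C j $$ (i1, i2) * C k $$ (i3, i4)) * eval_coeffs \<kappa> (ffun s Z i))"
proof -
  let ?S = "{i \<in> idx4 N. ffun s Z i \<noteq> 0\<^sub>v (s + 1)}"
  let ?c = "c2 N s Z \<theta> j k"
  let ?sum = "\<lambda>g. \<Sum>(i1, i2, i3, i4)\<in>?S. ?c (i1, i2, i3, i4) * g i1 i2 i3 i4"
  have "(\<integral>\<omega>. ?sum (\<lambda>i1 i2 i3 i4. u \<omega> $ i1 * u \<omega> $ i2 * u \<omega> $ i3 * u \<omega> $ i4) \<partial>M) =
      (\<integral>\<omega>. ?sum (\<lambda>i1 i2 i3 i4. U i1 \<omega> * U i2 \<omega> * U i3 \<omega> * U i4 \<omega>) \<partial>M)"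
    by (intro Bochner_Integration.integral_cong refl sum.cong) (auto simp: idx4_def u_U)
  also have "\<dots> = (\<Sum>i\<in>?S. ?c i * eval_coeffs \<kappa> (ffun s Z i)) +
      ?sum (\<lambda>i1 i2 i3 i4. V $$ (i1, i2) * V $$ (i3, i4)) +
      ?sum (\<lambda>i1 i2 i3 i4. V $$ (i1, i3) * V $$ (i2, i4)) +
      ?sum (\<lambda>i1 i2 i3 i4. V $$ (i1, i4) * V $$ (i2, i3))"
    by (rule expectation_sum4(2)) auto
  \<comment> \<open>The product of entries of \<open>C j\<close> and \<open>C k\<close> need not be
    invariant under this exchange of indices. The averaged coefficient is, because it depends on the
    tuple only through the symmetric f.\<close>
  also have "?sum (\<lambda>i1 i2 i3 i4. V $$ (i1, i2) * V $$ (i3, i4)) =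
      ?sum (\<lambda>i1 i2 i3 i4. V $$ (i1, i3) * V $$ (i2, i4))"
    by (rule sum.reindex_bij_witness[of _ "\<lambda>(i1, i2, i3, i4). (i1, i3, i2, i4)" "\<lambda>(i1, i2, i3, i4). (i1, i3, i2, i4)"])
      (auto simp: idx4_def c2_def ffun_swap)
  also have "?sum (\<lambda>i1 i2 i3 i4. V $$ (i1, i4) * V $$ (i2, i3)) =
      ?sum (\<lambda>i1 i2 i3 i4. V $$ (i1, i3) * V $$ (i2, i4))"
    by (rule sum.reindex_bij_witness[of _ "\<lambda>(i1, i2, i3, i4). (i1, i2, i4, i3)" "\<lambda>(i1, i2, i3, i4). (i1, i2, i4, i3)"])
      (auto simp: idx4_def c2_def ffun_swap)
  also have "?sum (\<lambda>i1 i2 i3 i4. V $$ (i1, i3) * V $$ (i2, i4)) =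
      (\<theta> $ 0)\<^sup>2 * ?sum (\<lambda>i1 i2 i3 i4. Gam s Z \<theta> i1 i3 * Gam s Z \<theta> i2 i4)"
    unfolding sum_distrib_left
    by (rule sum.cong[OF refl]) (auto simp: idx4_def power2_eq_square simp flip: V_Gam)
  finally show ?thesis unfolding sum_c2[symmetric] by simp
qed

end

section \<open>Blocks of the quasi-information matrix\<close>

theorem theorem3:
  fixes M :: "'w measure"
    and N p s :: nat
    and m :: "nat \<Rightarrow> nat"
    and X :: "real mat"
    and Z :: "nat \<Rightarrow> real mat"
    and \<beta> \<theta> :: "real vec"
    and \<alpha> :: "nat \<Rightarrow> nat \<Rightarrow> 'w \<Rightarrow> real"
    and \<sigma> \<mu>3 \<kappa> :: "nat \<Rightarrow> real"
    and y u :: "'w \<Rightarrow> real vec"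
    and c :: real
    and V I1 I11 I12 :: "real mat"
    and C :: "nat \<Rightarrow> real mat"
  assumes prob: "prob_space M"
    and N_pos: "N \<ge> 1"
    and m_pos: "\<And>t. t \<le> s \<Longrightarrow> m t \<ge> 1"
    and X_dim: "X \<in> carrier_mat N p"
    and X_rank: "vec_space.rank N X = p"
    and Z_dim: "\<And>t. t \<le> s \<Longrightarrow> Z t \<in> carrier_mat N (m t)"
    and m0: "m 0 = N"
    and Z0: "Z 0 = 1\<^sub>m N"
    and beta_dim: "\<beta> \<in> carrier_vec p"
    and vectors_indep:
      "prob_space.indep_vars M (\<lambda>t. \<Pi>\<^sub>M l\<in>{..<m t}. (borel :: real measure))
         (\<lambda>t \<omega>. \<lambda>l\<in>{..<m t}. \<alpha> t l \<omega>) {..s}"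
    and components_indep:
      "\<And>t. t \<le> s \<Longrightarrow> prob_space.indep_vars M (\<lambda>_. borel) (\<alpha> t) {..<m t}"
    and components_ident:
      "\<And>t l. t \<le> s \<Longrightarrow> l < m t \<Longrightarrow> distr M borel (\<alpha> t l) = distr M borel (\<alpha> t 0)"
    and fourth_moments:
      "\<And>t l. t \<le> s \<Longrightarrow> l < m t \<Longrightarrow> integrable M (\<lambda>\<omega>. \<alpha> t l \<omega> ^ 4)"
    and mean_zero: "\<And>t l. t \<le> s \<Longrightarrow> l < m t \<Longrightarrow> (\<integral>\<omega>. \<alpha> t l \<omega> \<partial>M) = 0"
    and variances:
      "\<And>t l. t \<le> s \<Longrightarrow> l < m t \<Longrightarrow> prob_space.variance M (\<alpha> t l) = (\<sigma> t)\<^sup>2"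
    and error_variance_pos: "(\<sigma> 0)\<^sup>2 > 0"
    and third: "\<And>t. \<mu>3 t = (\<integral>\<omega>. \<alpha> t 0 \<omega> ^ 3 \<partial>M)"
    and kappa: "\<And>t. \<kappa> t = (\<integral>\<omega>. \<alpha> t 0 \<omega> ^ 4 \<partial>M) - 3 * \<sigma> t ^ 4"
    and theta: "\<theta> = vec (s + 1) (\<lambda>t. if t = 0 then (\<sigma> 0)\<^sup>2 else (\<sigma> t)\<^sup>2 / (\<sigma> 0)\<^sup>2)"
    and model: "\<And>\<omega>. \<omega> \<in> space M \<Longrightarrow>
      y \<omega> = X *\<^sub>v \<beta> + vec N (\<lambda>i. \<Sum>t=1..s. (Z t *\<^sub>v vec (m t) (\<lambda>l. \<alpha> t l \<omega>)) $ i)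
             + vec N (\<lambda>i. \<alpha> 0 i \<omega>)"
    and u: "\<And>\<omega>. \<omega> \<in> space M \<Longrightarrow> u \<omega> = y \<omega> - X *\<^sub>v \<beta>"
    and V: "V = cov_mat N s Z \<theta>"
    and C: "C = Cmat N s Z \<theta>"
    and I1: "I1 = var_mat M (p + s + 1) (\<lambda>j \<omega>. score c N p s X Z (y \<omega>) (\<beta> @\<^sub>v \<theta>) j)"
    and I11: "I11 = info_part1 M N p s X Z \<theta> u"
    and I12: "I12 = info_part2 N p s X Z \<theta>"
  shows
    "I1 = I11 + I12 \<and>
     (\<forall>j<p. \<forall>k<p.
        I1 $$ (j, k) = col X j \<bullet> (mat_inv V *\<^sub>v col X k) \<and>
        I12 $$ (j, k) = col X j \<bullet> (mat_inv V *\<^sub>v col X k) \<and>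
        I11 $$ (j, k) = 0) \<and>
     (\<forall>j<p. \<forall>k\<le>s.
        I1 $$ (j, p + k) =
          (\<Sum>t\<le>s. \<mu>3 t * (\<Sum>l<m t. (col X j \<bullet> (mat_inv V *\<^sub>v col (Z t) l)) *
                                  (col (Z t) l \<bullet> (C k *\<^sub>v col (Z t) l)))) \<and>
        I1 $$ (j, p + k) =
          (\<integral>\<omega>. (\<Sum>(i1, i2, i3) \<in> {i \<in> idx3 N. tfun s Z i \<noteq> 0\<^sub>v (s + 1)}.
                  c1 N s X Z \<theta> j k (i1, i2, i3) * (u \<omega> $ i1 * u \<omega> $ i2 * u \<omega> $ i3)) \<partial>M) \<and>
        I11 $$ (j, p + k) = I1 $$ (j, p + k) \<and>
        I12 $$ (j, p + k) = 0) \<and>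
     (\<forall>j\<le>s. \<forall>k\<le>s.
        I1 $$ (p + j, p + k) =
          2 * mat_trace (C j * V * C k * V) +
          (\<Sum>t\<le>s. \<kappa> t * (\<Sum>l<m t. (col (Z t) l \<bullet> (C j *\<^sub>v col (Z t) l)) *
                                  (col (Z t) l \<bullet> (C k *\<^sub>v col (Z t) l)))) \<and>
        I1 $$ (p + j, p + k) =
          (\<integral>\<omega>. (\<Sum>(i1, i2, i3, i4) \<in> {i \<in> idx4 N. ffun s Z i \<noteq> 0\<^sub>v (s + 1)}.
                  c2 N s Z \<theta> j k (i1, i2, i3, i4) *
                  (u \<omega> $ i1 * u \<omega> $ i2 * u \<omega> $ i3 * u \<omega> $ i4)) \<partial>M) +
          (2 * mat_trace (C j * V * C k * V) -
           3 * (\<theta> $ 0)\<^sup>2 * (\<Sum>(i1, i2, i3, i4) \<in> {i \<in> idx4 N. ffun s Z i \<noteq> 0\<^sub>v (s + 1)}.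
                  c2 N s Z \<theta> j k (i1, i2, i3, i4) * (Gam s Z \<theta> i1 i3 * Gam s Z \<theta> i2 i4))) \<and>
        I11 $$ (p + j, p + k) =
          (\<integral>\<omega>. (\<Sum>(i1, i2, i3, i4) \<in> {i \<in> idx4 N. ffun s Z i \<noteq> 0\<^sub>v (s + 1)}.
                  c2 N s Z \<theta> j k (i1, i2, i3, i4) *
                  (u \<omega> $ i1 * u \<omega> $ i2 * u \<omega> $ i3 * u \<omega> $ i4)) \<partial>M) \<and>
        I12 $$ (p + j, p + k) =
          2 * mat_trace (C j * V * C k * V) -
          3 * (\<theta> $ 0)\<^sup>2 * (\<Sum>(i1, i2, i3, i4) \<in> {i \<in> idx4 N. ffun s Z i \<noteq> 0\<^sub>v (s + 1)}.
                  c2 N s Z \<theta> j k (i1, i2, i3, i4) * (Gam s Z \<theta> i1 i3 * Gam s Z \<theta> i2 i4)))"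
proof -
  interpret prob_space M by (rule prob)
  have rv: "random_variable borel (\<alpha> t l)" if "t \<le> s" "l < m t" for t l
    using components_indep[OF that(1)] that(2) by (auto simp: indep_vars_def2)
  \<comment> \<open>All components of one vector share a distribution, so the moments of component
    0, which define \<open>\<mu>3\<close> and \<open>\<kappa>\<close>, serve for each of
    them.\<close>
  have moment_0: "expectation (\<lambda>\<omega>. \<alpha> t l \<omega> ^ n) = expectation (\<lambda>\<omega>. \<alpha> t 0 \<omega> ^ n)"
    if "t \<le> s" "l < m t" for t l n
  proof -
    have "expectation (\<lambda>\<omega>. \<alpha> t l \<omega> ^ n) = integral\<^sup>L (distr M borel (\<alpha> t l)) (\<lambda>x. x ^ n)"
      using rv[OF that] by (simp add: integral_distr)
    also have "\<dots> = integral\<^sup>L (distr M borel (\<alpha> t 0)) (\<lambda>x. x ^ n)"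
      using components_ident[OF that] by simp
    also have "\<dots> = expectation (\<lambda>\<omega>. \<alpha> t 0 \<omega> ^ n)"
      using rv[of t 0] that by (simp add: integral_distr)
    finally show ?thesis .
  qed
  have u_eq: "u \<omega> = vec N (\<lambda>i. \<Sum>t\<le>s. \<Sum>l<m t. Z t $$ (i, l) * \<alpha> t l \<omega>)"
    if "\<omega> \<in> space M" for \<omega>
  proof (rule eq_vecI)
    fix i assume "i < dim_vec (vec N (\<lambda>i. \<Sum>t\<le>s. \<Sum>l<m t. Z t $$ (i, l) * \<alpha> t l \<omega>))"
    then have i: "i < N" by simp
    have t: "(Z t *\<^sub>v vec (m t) (\<lambda>l. \<alpha> t l \<omega>)) $ i = (\<Sum>l<m t. Z t $$ (i, l) * \<alpha> t l \<omega>)"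
      if "t \<le> s" for t
      using Z_dim[OF that] i by (auto simp: scalar_prod_def atLeast0LessThan intro!: sum.cong)
    \<comment> \<open>The separate error vector of the model equation is the summand
      \<open>t = 0\<close>, because \<open>Z 0\<close> is the identity.\<close>
    have "(\<Sum>l<m 0. Z 0 $$ (i, l) * \<alpha> 0 l \<omega>) = \<alpha> 0 i \<omega>"
      using i by (simp add: m0 Z0 if_distrib[of "\<lambda>x. x * _"] cong: if_cong)
    moreover have "{..s} = insert 0 {1..s}" by auto
    moreover have "u \<omega> $ i = (\<Sum>t=1..s. (Z t *\<^sub>v vec (m t) (\<lambda>l. \<alpha> t l \<omega>)) $ i) + \<alpha> 0 i \<omega>"
      unfolding u[OF that] model[OF that] using carrier_matD(1)[OF X_dim] i by (simp del: index_mult_mat_vec)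
    ultimately show "u \<omega> $ i = vec N (\<lambda>i. \<Sum>t\<le>s. \<Sum>l<m t. Z t $$ (i, l) * \<alpha> t l \<omega>) $ i"
      using i by (simp add: t del: index_mult_mat_vec)
  next
    show "dim_vec (u \<omega>) = dim_vec (vec N (\<lambda>i. \<Sum>t\<le>s. \<Sum>l<m t. Z t $$ (i, l) * \<alpha> t l \<omega>))"
      unfolding u[OF that] model[OF that] using X_dim by simp
  qed
  interpret mixed_model N s m Z \<sigma> \<theta> M \<alpha> \<mu>3 \<kappa> u
  proof
    show "expectation (\<lambda>\<omega>. \<alpha> t l \<omega> ^ 2) = (\<sigma> t)\<^sup>2" if "t \<le> s" "l < m t" for t l
      using variances[OF that] mean_zero[OF that] by simp
    show "expectation (\<lambda>\<omega>. \<alpha> t l \<omega> ^ 4) = \<kappa> t + 3 * ((\<sigma> t)\<^sup>2)\<^sup>2" if "t \<le> s" "l < m t" for t l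
      using moment_0[OF that] by (simp add: kappa)
    show "expectation (\<lambda>\<omega>. \<alpha> t l \<omega> ^ 3) = \<mu>3 t" if "t \<le> s" "l < m t" for t l
      using moment_0[OF that] by (simp add: third)
    show "u \<omega> \<in> carrier_vec N" if "\<omega> \<in> space M" for \<omega>
      by (simp add: u_eq[OF that])
    show "u \<omega> $ i = (\<Sum>t\<le>s. \<Sum>l<m t. Z t $$ (i, l) * \<alpha> t l \<omega>)"
      if "\<omega> \<in> space M" "i < N" for \<omega> i
      using that(2) by (simp add: u_eq[OF that(1)])
  qed (fact Z_dim m0 Z0 error_variance_pos theta vectors_indep components_indep fourth_moments mean_zero)+

  let ?S = "\<lambda>j \<omega>. score c N p s X Z (y \<omega>) (\<beta> @\<^sub>v \<theta>) j"
  let ?q = "\<lambda>j. mat_inv V *\<^sub>v col X j"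
  have V': "cov_mat N s Z \<theta> = V" and C': "Cmat N s Z \<theta> = C" by (simp_all add: V C)
  note W = W[unfolded V'] and C_carrier = C_carrier[unfolded C']
  have y_dim: "y \<omega> \<in> carrier_vec N" if "\<omega> \<in> space M" for \<omega>
    unfolding model[OF that] using carrier_matD(1)[OF X_dim] by (intro carrier_vecI) simp
  have x: "col X j \<in> carrier_vec N" if "j < p" for j
    using X_dim that by auto
  have q: "?q j \<in> carrier_vec N" if "j < p" for j
    using W(1) x[OF that] by auto
  have score1: "?S j \<omega> = lform (?q j) \<omega> + 0" if "\<omega> \<in> space M" "j < p" for j \<omega>
    using score_beta[OF X_dim beta_dim y_dim[OF that(1)] that(2), of c] lform_u[OF that(1) q[OF that(2)]]
    by (simp add: V' u[OF that(1)])
  have score2: "?S (p + k) \<omega> = qform (C k) \<omega> + - (mat_trace (mat_inv V * slope k) / 2)"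
    if "\<omega> \<in> space M" "k \<le> s" for k \<omega>
    using score_theta[OF X_dim beta_dim y_dim[OF that(1)] that(2), of c] qform_u[OF that(1) C_carrier[OF that(2)]]
    by (simp add: V' C' u[OF that(1)])
  have I1_entry: "I1 $$ (a, b) = (\<integral>\<omega>. (?S a \<omega> - (\<integral>\<omega>'. ?S a \<omega>' \<partial>M)) *
      (?S b \<omega> - (\<integral>\<omega>'. ?S b \<omega>' \<partial>M)) \<partial>M)" if "a < p + s + 1" "b < p + s + 1" for a b
    using that by (simp add: I1 var_mat_def)
  have I1_sym: "I1 $$ (a, b) = I1 $$ (b, a)" if "a < p + s + 1" "b < p + s + 1" for a b
    using that by (simp add: I1_entry mult.commute)

  have bb: "I1 $$ (j, k) = col X j \<bullet> ?q k" if "j < p" "k < p" for j k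
  proof -
    have "I1 $$ (j, k) = (\<Sum>i<N. \<Sum>i'<N. ?q j $ i * V $$ (i, i') * ?q k $ i')"
      using that expectation_lform
      by (subst I1_entry, simp, simp, subst covariance_shift[OF _ _ _ score1 score1])
        (auto simp: expectation_lform_lform V')
    also have "\<dots> = ?q j \<bullet> (V *\<^sub>v ?q k)"
      using V_carrier[of \<theta>] q that by (simp add: mat_quad_sum V')
    \<comment> \<open>The middle V cancels one inverse; the other is then moved across the scalar
      product by symmetry.\<close>
    also have "V *\<^sub>v ?q k = col X k"
      using V_carrier[of \<theta>] W x[OF that(2)] by (simp add: V' flip: assoc_mult_mat_vec)
    also have "?q j \<bullet> col X k = col X j \<bullet> ?q k"
      using transpose_vec_mult_scalar[OF W(1) x[OF that(2)] x[OF that(1)]] W_sym by (simp add: V')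
    finally show ?thesis .
  qed
  let ?B = "\<lambda>j k. \<Sum>i\<in>idx3 N. (case i of (i1, i2, i3) \<Rightarrow> ?q j $ i1 * C k $$ (i2, i3)) * eval_coeffs \<mu>3 (tfun s Z i)"
  have bt: "I1 $$ (j, p + k) = ?B j k" if "j < p" "k \<le> s" for j k
  proof -
    have "I1 $$ (j, p + k) = expectation (\<lambda>\<omega>. lform (?q j) \<omega> * qform (C k) \<omega>) -
        expectation (lform (?q j)) * expectation (qform (C k))"
      using that
      by (subst I1_entry, simp, simp, subst covariance_shift[OF _ _ _ score1 score2])
        (auto simp: expectation_lform expectation_qform(1) expectation_lform_qform(1))
    \<comment> \<open>The linear form has mean zero, so the product of expectations drops out and
      only the third moments remain.\<close>
    then show ?thesis
      by (simp only: expectation_lform expectation_lform_qform(2) mult_zero_left diff_zero)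
  qed
  let ?T = "\<lambda>j k. \<Sum>i\<in>idx4 N. (case i of (i1, i2, i3, i4) \<Rightarrow> C j $$ (i1, i2) * C k $$ (i3, i4)) *
    eval_coeffs \<kappa> (ffun s Z i)"
  have tt: "I1 $$ (p + j, p + k) = ?T j k + 2 * mat_trace (C j * V * C k * V)" if "j \<le> s" "k \<le> s" for j k
  proof -
    have "I1 $$ (p + j, p + k) = expectation (\<lambda>\<omega>. qform (C j) \<omega> * qform (C k) \<omega>) -
        expectation (qform (C j)) * expectation (qform (C k))"
      using that
      by (subst I1_entry, simp, simp, subst covariance_shift[OF _ _ _ score2 score2])
        (auto simp: expectation_qform(1) covariance_qform(1))
    then show ?thesis
      using sum_quad_V_eq_trace[OF that, unfolded V' C'] covariance_qform(2)[of "C j" "C k", unfolded V']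
      by linarith
  qed
  note c1_eq = expectation_c1[where X = X, unfolded V' C']
  note c2_eq = expectation_c2[unfolded V' C']

  let ?E1 = "\<lambda>j k. \<integral>\<omega>. (\<Sum>(i1, i2, i3) \<in> {i \<in> idx3 N. tfun s Z i \<noteq> 0\<^sub>v (s + 1)}.
    c1 N s X Z \<theta> j k (i1, i2, i3) * (u \<omega> $ i1 * u \<omega> $ i2 * u \<omega> $ i3)) \<partial>M"
  let ?E2 = "\<lambda>j k. \<integral>\<omega>. (\<Sum>(i1, i2, i3, i4) \<in> {i \<in> idx4 N. ffun s Z i \<noteq> 0\<^sub>v (s + 1)}.
    c2 N s Z \<theta> j k (i1, i2, i3, i4) * (u \<omega> $ i1 * u \<omega> $ i2 * u \<omega> $ i3 * u \<omega> $ i4)) \<partial>M"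
  let ?G = "\<lambda>j k. 2 * mat_trace (C j * V * C k * V) -
    3 * (\<theta> $ 0)\<^sup>2 * (\<Sum>(i1, i2, i3, i4) \<in> {i \<in> idx4 N. ffun s Z i \<noteq> 0\<^sub>v (s + 1)}.
      c2 N s Z \<theta> j k (i1, i2, i3, i4) * (Gam s Z \<theta> i1 i3 * Gam s Z \<theta> i2 i4))"
  have I11_entry: "I11 $$ (a, b) = (if a < p \<and> b < p then 0 else if a < p then ?E1 a (b - p)
      else if b < p then ?E1 b (a - p) else ?E2 (a - p) (b - p))"
    if "a < p + s + 1" "b < p + s + 1" for a b
    using that unfolding I11 info_part1_def Let_def by (subst index_mat) auto
  have I12_entry: "I12 $$ (a, b) = (if a < p \<and> b < p then col X a \<bullet> ?q b
      else if a < p \<or> b < p then 0 else ?G (a - p) (b - p))"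
    if "a < p + s + 1" "b < p + s + 1" for a b
    using that unfolding I12 info_part2_def Let_def V' C' by (subst index_mat) auto
  have E1: "?E1 j k = I1 $$ (j, p + k)" if "j < p" "k \<le> s" for j k
    unfolding bt[OF that] by (rule c1_eq)
  \<comment> \<open>The \<Gamma> term reduces the expectation to its \<kappa> part, while the trace
    in \<open>?G\<close> supplies the pairings of the exact covariance.\<close>
  have E2: "?E2 j k + ?G j k = I1 $$ (p + j, p + k)" if "j \<le> s" "k \<le> s" for j k
    unfolding tt[OF that] using c2_eq[of j k] by linarith

  have "I1 = I11 + I12"
  proof (rule eq_matI)
    have dims: "dim_row I12 = p + s + 1" "dim_col I12 = p + s + 1"
      by (simp_all add: I12 info_part2_def Let_def)
    show "dim_row I1 = dim_row (I11 + I12)" "dim_col I1 = dim_col (I11 + I12)"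
      by (simp_all add: dims I1 var_mat_def)
    fix a b assume "a < dim_row (I11 + I12)" "b < dim_col (I11 + I12)"
    then have ab: "a < p + s + 1" "b < p + s + 1" by (simp_all add: dims)
    have "(I11 + I12) $$ (a, b) = I11 $$ (a, b) + I12 $$ (a, b)"
      using ab by (simp add: dims)
    also have "\<dots> = I1 $$ (a, b)"
    proof (cases "a < p"; cases "b < p")
      assume "a < p" "b < p"
      then show ?thesis unfolding I11_entry[OF ab] I12_entry[OF ab] by (simp add: bb)
    next
      assume "a < p" "\<not> b < p"
      then show ?thesis
        unfolding I11_entry[OF ab] I12_entry[OF ab] using E1[of a "b - p"] ab by simp
    next
      \<comment> \<open>In this block \<open>info_part1\<close> uses exchanged arguments, so
        symmetry of the covariance matrix reduces it to the transposed block.\<close>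
      assume "\<not> a < p" "b < p"
      then show ?thesis
        unfolding I11_entry[OF ab] I12_entry[OF ab] using E1[of b "a - p"] I1_sym[OF ab] ab by simp
    next
      assume "\<not> a < p" "\<not> b < p"
      then show ?thesis
        unfolding I11_entry[OF ab] I12_entry[OF ab] using E2[of "a - p" "b - p"] ab by simp
    qed
    finally show "I1 $$ (a, b) = (I11 + I12) $$ (a, b)" by simp
  qed
  moreover have "I1 $$ (j, k) = col X j \<bullet> ?q k \<and> I12 $$ (j, k) = col X j \<bullet> ?q k \<and> I11 $$ (j, k) = 0"
    if "j < p" "k < p" for j k
    using that by (simp add: bb I11_entry I12_entry)
  moreover have "I1 $$ (j, p + k) = (\<Sum>t\<le>s. \<mu>3 t * (\<Sum>l<m t. (col X j \<bullet> (mat_inv V *\<^sub>v col (Z t) l)) *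
        (col (Z t) l \<bullet> (C k *\<^sub>v col (Z t) l)))) \<and>
      I1 $$ (j, p + k) = ?E1 j k \<and> I11 $$ (j, p + k) = I1 $$ (j, p + k) \<and> I12 $$ (j, p + k) = 0"
    if "j < p" "k \<le> s" for j k
  proof (intro conjI)
    have W_adj: "?q j \<bullet> col (Z t) l = col X j \<bullet> (mat_inv V *\<^sub>v col (Z t) l)" if "t \<le> s" "l < m t" for t l
      using transpose_vec_mult_scalar[OF W(1) _ x[OF \<open>j < p\<close>], of "col (Z t) l"] W_sym Z_dim[OF that(1)] that
      by (simp add: V')
    show "I1 $$ (j, p + k) = (\<Sum>t\<le>s. \<mu>3 t * (\<Sum>l<m t. (col X j \<bullet> (mat_inv V *\<^sub>v col (Z t) l)) *
        (col (Z t) l \<bullet> (C k *\<^sub>v col (Z t) l))))"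
      unfolding bt[OF that] sum_tfun_eq_forms[OF q[OF that(1)] C_carrier[OF that(2)]]
      by (simp add: W_adj)
    show "I1 $$ (j, p + k) = ?E1 j k" using E1[OF that] ..
    show "I11 $$ (j, p + k) = I1 $$ (j, p + k)" using E1[OF that] that by (subst I11_entry) auto
    show "I12 $$ (j, p + k) = 0" using that by (subst I12_entry) auto
  qed
  moreover have "I1 $$ (p + j, p + k) = 2 * mat_trace (C j * V * C k * V) +
        (\<Sum>t\<le>s. \<kappa> t * (\<Sum>l<m t. (col (Z t) l \<bullet> (C j *\<^sub>v col (Z t) l)) *
          (col (Z t) l \<bullet> (C k *\<^sub>v col (Z t) l)))) \<and>
      I1 $$ (p + j, p + k) = ?E2 j k + ?G j k \<and> I11 $$ (p + j, p + k) = ?E2 j k \<and>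
      I12 $$ (p + j, p + k) = ?G j k"
    if "j \<le> s" "k \<le> s" for j k
  proof (intro conjI)
    show "I1 $$ (p + j, p + k) = 2 * mat_trace (C j * V * C k * V) +
        (\<Sum>t\<le>s. \<kappa> t * (\<Sum>l<m t. (col (Z t) l \<bullet> (C j *\<^sub>v col (Z t) l)) *
          (col (Z t) l \<bullet> (C k *\<^sub>v col (Z t) l))))"
      unfolding tt[OF that] sum_ffun_eq_forms[OF C_carrier[OF that(1)] C_carrier[OF that(2)]] by simp
    show "I1 $$ (p + j, p + k) = ?E2 j k + ?G j k" using E2[OF that] ..
    show "I11 $$ (p + j, p + k) = ?E2 j k" using that by (subst I11_entry) auto
    show "I12 $$ (p + j, p + k) = ?G j k" using that by (subst I12_entry) auto
  qed
  ultimately show ?thesis by blast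
qed

end
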